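(* Let $q$ be a power of a prime $p$, $K$ an algebraic closure of $\mathbb{F}_q$, with $\mathrm{PSL}(3,q)$ acting on $\mathrm{PG}(2,K)$. Then $d(\mathrm{PSL}(3,q))=q^3-q^2$, $\varepsilon(\mathrm{PSL}(3,q))=q^2-q$, and the DGZ curve is the only $\mathrm{PSL}(3,q)$-invariant irreducible plane curve of degree $q^3-q^2$.
   Context: Plane curves are over $K$; irreducible means irreducible over $K$; $G$-invariant means mapped onto itself by every element of $G$. $d(G)$ is the smallest degree of a $G$-invariant irreducible plane curve other than a line; $\varepsilon(G)=d'(G)-d(G)$ where $d'(G)$ is the smallest degree larger than $d(G)$ of a $G$-invariant irreducible plane curve. The DGZ curve has affine equation $\frac{(X^{q^3}-X)(Y^{q}-Y)-(Y^{q^3}-Y)(X^{q}-X)}{(X^{q^2}-X)(Y^q-Y)-(Y^{q^2}-Y)(X^q-X)}=0$ (exact polynomial quotient). *)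

theory Defs
  imports "HOL-Analysis.Analysis" "HOL-Computational_Algebra.Polynomial"
begin

text \<open>Homogeneous polynomials in K[X,Y,Z] are represented as elements of the
  iterated polynomial ring K[X][Y][Z] = 'k poly poly poly.
  The innermost variable is X, the middle one Y, the outermost one Z.\<close>

type_synonym 'k poly3 = "'k poly poly poly"

definition const3 :: "'k::comm_ring_1 \<Rightarrow> 'k poly3" where
  "const3 c = [:[:[:c:]:]:]"

definition varX :: "'k::comm_ring_1 poly3" where "varX = [:[:[:0, 1:]:]:]"
definition varY :: "'k::comm_ring_1 poly3" where "varY = [:[:0, 1:]:]"
definition varZ :: "'k::comm_ring_1 poly3" where "varZ = [:0, 1:]"

definition eval3 :: "'k::comm_ring_1 poly3 \<Rightarrow> 'k poly3 \<Rightarrow> 'k poly3 \<Rightarrow> 'k poly3 \<Rightarrow> 'k poly3" where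
  "eval3 F a b c =
     poly (map_poly (\<lambda>G. poly (map_poly (\<lambda>H. poly (map_poly const3 H) a) G) b) F) c"

definition coeff3 :: "'k::comm_ring_1 poly3 \<Rightarrow> nat \<Rightarrow> nat \<Rightarrow> nat \<Rightarrow> 'k" where
  "coeff3 F i j k = coeff (coeff (coeff F k) j) i"

definition homogeneous3 :: "nat \<Rightarrow> 'k::comm_ring_1 poly3 \<Rightarrow> bool" where
  "homogeneous3 d F \<longleftrightarrow> (\<forall>i j k. coeff3 F i j k \<noteq> 0 \<longrightarrow> i + j + k = d)"

definition linrow :: "'k::comm_ring_1 ^3^3 \<Rightarrow> 3 \<Rightarrow> 'k poly3" where
  "linrow A i = const3 (A$i$1) * varX + const3 (A$i$2) * varY + const3 (A$i$3) * varZ"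

definition transform3 :: "'k::comm_ring_1 ^3^3 \<Rightarrow> 'k poly3 \<Rightarrow> 'k poly3" where
  "transform3 A F = eval3 F (linrow A 1) (linrow A 2) (linrow A 3)"

text \<open>SL(3,q): matrices over the subfield F_q = {x. x^q = x} of K with determinant 1;
  their action on PG(2,K) is the action of PSL(3,q).\<close>
definition SL3 :: "nat \<Rightarrow> ('k::field ^3^3) set" where
  "SL3 q = {A. (\<forall>i j. (A$i$j) ^ q = A$i$j) \<and> det A = 1}"

text \<open>F is (an equation of) a G-invariant irreducible plane curve of degree d:
  F homogeneous of degree d, irreducible in K[X,Y,Z], and every element of G maps
  the curve onto itself, i.e. F(A x) is a nonzero scalar multiple of F.\<close>
definition inv_irr_curve :: "('k::field ^3^3) set \<Rightarrow> nat \<Rightarrow> 'k poly3 \<Rightarrow> bool" where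
  "inv_irr_curve G d F \<longleftrightarrow> homogeneous3 d F \<and> irreducible F \<and>
     (\<forall>A\<in>G. \<exists>c. c \<noteq> 0 \<and> transform3 A F = const3 c * F)"

text \<open>d(G): smallest degree of a G-invariant irreducible curve other than a line
  (irreducible curves of degree 1 are exactly the lines).\<close>
definition dG :: "('k::field ^3^3) set \<Rightarrow> nat" where
  "dG G = (LEAST d. 2 \<le> d \<and> (\<exists>F. inv_irr_curve G d F))"

definition d'G :: "('k::field ^3^3) set \<Rightarrow> nat" where
  "d'G G = (LEAST d. dG G < d \<and> (\<exists>F. inv_irr_curve G d F))"

definition epsG :: "('k::field ^3^3) set \<Rightarrow> nat" where
  "epsG G = d'G G - dG G"

text \<open>Homogenised numerator and denominator of the DGZ affine equation
  (homogenising variable Z) and the homogenised DGZ polynomial (exact quotient).\<close>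
definition hX :: "nat \<Rightarrow> nat \<Rightarrow> 'k::comm_ring_1 poly3" where
  "hX q m = varX ^ (q ^ m) - varX * varZ ^ (q ^ m - 1)"
definition hY :: "nat \<Rightarrow> nat \<Rightarrow> 'k::comm_ring_1 poly3" where
  "hY q m = varY ^ (q ^ m) - varY * varZ ^ (q ^ m - 1)"

definition DGZ :: "nat \<Rightarrow> 'k::field poly3" where
  "DGZ q = (hX q 3 * hY q 1 - hY q 3 * hX q 1) div (hX q 2 * hY q 1 - hY q 2 * hX q 1)"

end

theory Submission
  imports Defs "Berlekamp_Zassenhaus.Unique_Factorization_Poly"
begin

text \<open>
  Restrict an SL(3,q)-invariant F to the line X = 0, that is, take f = F(0, 1, T). Invariance
  under Z \<mapsto> Z + aX makes f a polynomial in T^q, invariance under Z \<mapsto> Z + aY makes it a polynomial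
  in (T^q - T)^q, the Weyl element exchanging Y and Z gives ord f + deg f = deg F, and the
  torus makes all exponents divisible by q - 1. If X does not divide F, this forces
  deg F = q(q - 1)(v + qw) with v \<le> w, so the possible degrees start with q^3 - q^2 and q^3 - q.

  These two degrees are attained by the Dickson invariants D1 and D2, and D1 is the DGZ
  polynomial. Any irreducible component of them turns out to be invariant as well, and then the
  degree formula leaves no room for a second component:

  \<^item> A line of PG(2,q) meets D1 = 0 only in points of PG(2,q^2), and at such a point D1 looks like
    u^(q-1) + v^q, so that only one component passes through it. The elations with that line as
    axis fix the point, hence they fix the component.

  \<^item> At a point of PG(2,q), D2 = 0 has q^2 - q distinct tangents. The elations with that point as
    centre preserve the tangents, hence they fix every component through the point.
\<close>

subsection \<open>Polynomials in three variables\<close>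

text \<open>The degrees in question belong to (v, w) = (0, 1) and (1, 1), where v + q*w is q and q +
  1. The obstacle is irreducibility: the group could permute the components of D1 or D2, so none of
  them is invariant a priori. The degree formula does not ask for irreducibility, only for
  invariance under four families of elations; the work is to show that a component is fixed by each
  family. For D1 this can be done along the axis. For D2 the axis meets the curve in few points with
  high multiplicity, and centres replace axes; but a centre is useful only if it lies on the
  component, so coordinates must be found in which the component contains all three vertices of the
  triangle of reference. Such changes of coordinates are available because D1 and D2 are invariant
  under GL(3,q). Uniqueness compares an invariant form with a multiple of D1. The difference may be
  reducible and even divisible by X, where the degree formula says nothing; this case has to be
  excluded by a separate count.\<close>

definition rhom :: "('a::comm_ring_1 \<Rightarrow> 'b::comm_ring_1) \<Rightarrow> bool" where
  "rhom h \<longleftrightarrow> h 0 = 0 \<and> h 1 = 1 \<and> (\<forall>x y. h (x + y) = h x + h y) \<and> (\<forall>x y. h (x * y) = h x * h y)"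

lemma rhomD:
  assumes "rhom h"
  shows "h 0 = 0" "h 1 = 1" "h (x + y) = h x + h y" "h (x * y) = h x * h y"
    "h (- x) = - h x" "h (x - y) = h x - h y" "h (x ^ n) = h x ^ n"
proof -
  show 1: "h 0 = 0" "h 1 = 1" "\<And>x y. h (x + y) = h x + h y" "h (x * y) = h x * h y"
    using assms by (auto simp: rhom_def)
  show m: "h (- x) = - h x" for x
    using 1(3)[of x "- x"] 1(1) by (simp add: eq_neg_iff_add_eq_0 add.commute)
  show "h (x - y) = h x - h y"
    using 1(3)[of x "- y"] m[of y] by simp
  show "h (x ^ n) = h x ^ n"
    using assms by (induct n) (auto simp: rhom_def)
qed

lemma rhom_const: "rhom (\<lambda>c. [:c:])"
  by (auto simp: rhom_def)

lemma rhom_comp: "rhom g \<Longrightarrow> rhom h \<Longrightarrow> rhom (\<lambda>x. g (h x))"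
  by (auto simp: rhom_def)

lemma rhom_const3: "rhom const3"
  unfolding const3_def[abs_def] by (intro rhom_comp[OF rhom_const] rhom_const)

abbreviation ord0 :: "'a::idom poly \<Rightarrow> nat" where
  "ord0 \<equiv> Polynomial.order 0"

definition poly_ev :: "('a::comm_ring_1 \<Rightarrow> 'b::comm_ring_1) \<Rightarrow> 'b \<Rightarrow> 'a poly \<Rightarrow> 'b" where
  "poly_ev h a p = poly (map_poly h p) a"

lemma poly_ev_pCons [simp]: "rhom h \<Longrightarrow> poly_ev h a (pCons c p) = h c + a * poly_ev h a p"
  by (cases "c = 0 \<and> p = 0") (auto simp: poly_ev_def map_poly_pCons rhom_def)

lemma poly_ev_0 [simp]: "poly_ev h a 0 = 0"
  by (simp add: poly_ev_def)

lemma rhom_poly_ev: assumes "rhom h" shows "rhom (poly_ev h a)"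
proof -
  note h = rhomD[OF assms]
  note [simp] = poly_ev_pCons[OF assms]
  have add: "poly_ev h a (p + q) = poly_ev h a p + poly_ev h a q" for p q
    by (induct p q rule: poly_induct2) (simp_all add: h algebra_simps)
  have sm: "poly_ev h a (smult c q) = h c * poly_ev h a q" for c q
    by (induct q) (simp_all add: h algebra_simps)
  have mult: "poly_ev h a (p * q) = poly_ev h a p * poly_ev h a q" for p q
    by (induct p) (simp_all add: h add sm algebra_simps)
  have one: "poly_ev h a 1 = 1"
    using poly_ev_pCons[OF assms, of a 1 0] h by (simp flip: one_pCons)
  show ?thesis unfolding rhom_def using add mult one by simp
qed

lemma poly_ev_hom:
  assumes "rhom g" "rhom h"
  shows "g (poly_ev h a p) = poly_ev (\<lambda>c. g (h c)) (g a) p"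
  by (induct p) (simp_all add: assms rhomD[OF assms(1)] rhom_comp)

text \<open>The universal property of K[X, Y, Z]. Substitution, grading, restriction to a line,
  affine charts and branches are all instances, and \<open>ev_hom\<close> makes them compatible with
  one another.\<close>

definition ev :: "('k::comm_ring_1 \<Rightarrow> 'r::comm_ring_1) \<Rightarrow> 'r \<Rightarrow> 'r \<Rightarrow> 'r \<Rightarrow> 'k poly3 \<Rightarrow> 'r" where
  "ev h a b c = poly_ev (poly_ev (poly_ev h a) b) c"

lemma eval3_eq_ev: "eval3 F a b c = ev const3 a b c F"
  by (simp add: eval3_def ev_def poly_ev_def[abs_def])

lemma rhom_ev: "rhom h \<Longrightarrow> rhom (ev h a b c)"
  unfolding ev_def by (intro rhom_poly_ev)

lemma ev_hom:
  assumes "rhom g" "rhom h"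
  shows "g (ev h a b c F) = ev (\<lambda>x. g (h x)) (g a) (g b) (g c) F"
  unfolding ev_def
  by (simp add: poly_ev_hom[OF assms(1)] rhom_poly_ev assms poly_ev_hom[OF assms])

lemma ev_var [simp]:
  assumes "rhom h"
  shows "ev h a b c (const3 k) = h k" "ev h a b c varX = a" "ev h a b c varY = b" "ev h a b c varZ = c"
proof -
  note 1 = rhom_poly_ev[OF assms, of a]
  note 2 = rhom_poly_ev[OF 1, of b]
  note [simp] = rhomD[OF assms] rhomD[OF 1] rhomD[OF 2] rhomD[OF rhom_poly_ev[OF 2, of c]]
  show "ev h a b c (const3 k) = h k" "ev h a b c varX = a" "ev h a b c varY = b" "ev h a b c varZ = c"
    by (simp_all add: ev_def const3_def varX_def varY_def varZ_def assms 1 2)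
qed

text \<open>With Z as the outermost variable, a substitution that moves only Z is a composition of
  univariate polynomials over K[X, Y]. For this reason elations are treated first when they move Z,
  and the others are conjugated to these.\<close>

lemma subst3_Z: "ev const3 varX varY W F = pcompose F W"
proof -
  have 1: "poly_ev const3 varX H = [:[:H:]:]" for H :: "'a poly"
    by (induct H) (simp_all add: rhom_const3, simp add: const3_def varX_def)
  have 2: "poly_ev (\<lambda>H. [:[:H:]:]) varY G = [:G:]" for G :: "'a poly poly"
    by (induct G) (simp_all add: rhom_comp[OF rhom_const rhom_const], simp add: varY_def)
  have 3: "poly_ev (\<lambda>G. [:G:]) W F = pcompose F W" for F :: "'a poly3"
    by (induct F) (simp_all add: rhom_const pcompose_pCons)
  show ?thesis unfolding ev_def 1[abs_def] 2[abs_def] 3 ..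
qed

lemma ev_id: "ev const3 varX varY varZ F = F"
  unfolding subst3_Z varZ_def by (rule pcompose_idR)

lemma poly3_induct [case_names const add X Y Z]:
  assumes c: "\<And>k. P (const3 k)" and a: "\<And>F G. P F \<Longrightarrow> P G \<Longrightarrow> P (F + G)"
    and X: "\<And>F. P F \<Longrightarrow> P (varX * F)" and Y: "\<And>F. P F \<Longrightarrow> P (varY * F)" and Z: "\<And>F. P F \<Longrightarrow> P (varZ * F)"
  shows "P F"
proof -
  have 1: "P [:[:H:]:]" for H :: "'a poly"
  proof (induct H)
    case 0 show ?case using c[of 0] by (simp add: const3_def)
  next
    case (pCons k H)
    have "[:[:pCons k H:]:] = const3 k + varX * [:[:H:]:]" by (simp add: const3_def varX_def)
    then show ?case using a[OF c X] pCons by metis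
  qed
  have 2: "P [:G:]" for G :: "'a poly poly"
  proof (induct G)
    case 0 show ?case using c[of 0] by (simp add: const3_def)
  next
    case (pCons k H)
    have "[:pCons k H:] = [:[:k:]:] + varY * [:H:]" by (simp add: varY_def)
    then show ?case using a[OF 1 Y] pCons by metis
  qed
  show ?thesis
  proof (induct F)
    case 0 show ?case using c[of 0] by (simp add: const3_def)
  next
    case (pCons k H)
    have "pCons k H = [:k:] + varZ * H" by (simp add: varZ_def)
    then show ?case using a[OF 2 Z] pCons by metis
  qed
qed

abbreviation subst3 :: "'k::comm_ring_1 poly3 \<Rightarrow> 'k poly3 \<Rightarrow> 'k poly3 \<Rightarrow> 'k poly3 \<Rightarrow> 'k poly3" where
  "subst3 \<equiv> ev const3"

lemmas rhom_subst3 = rhom_ev[OF rhom_const3]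

lemma ev_subst3:
  "rhom h \<Longrightarrow> ev h a b c (subst3 A B C F) = ev h (ev h a b c A) (ev h a b c B) (ev h a b c C) F"
  by (subst ev_hom) (simp_all add: rhom_ev rhom_const3)

lemma const3_simps:
  "const3 0 = 0" "const3 1 = 1" "const3 (a + b) = const3 a + const3 b"
  "const3 (a * b) = const3 a * const3 b" "const3 (- a) = - const3 a" "const3 (a ^ n) = const3 a ^ n"
  "const3 (a - b) = const3 a - const3 b"
  by (rule rhomD[OF rhom_const3])+

lemma const3_eq_0_iff [simp]: "const3 a = 0 \<longleftrightarrow> a = 0"
  by (simp add: const3_def)

lemma coeff3_simps:
  "coeff3 0 i j k = 0"
  "coeff3 (F + G) i j k = coeff3 F i j k + coeff3 G i j k"
  "coeff3 (const3 c) i j k = (if i = 0 \<and> j = 0 \<and> k = 0 then c else 0)"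
  "coeff3 (const3 c * F) i j k = c * coeff3 F i j k"
  "coeff3 (varX * F) i j k = (if i = 0 then 0 else coeff3 F (i - 1) j k)"
  "coeff3 (varY * F) i j k = (if j = 0 then 0 else coeff3 F i (j - 1) k)"
  "coeff3 (varZ * F) i j k = (if k = 0 then 0 else coeff3 F i j (k - 1))"
  by (auto simp: coeff3_def const3_def varX_def varY_def varZ_def coeff_pCons split: nat.splits)

lemma poly3_eqI: "(\<And>i j k. coeff3 F i j k = coeff3 G i j k) \<Longrightarrow> F = G"
  by (auto simp: coeff3_def poly_eq_iff)

text \<open>F(uX, uY, uZ), as a polynomial in u: its coefficients are the homogeneous parts of F.\<close>
definition grading :: "'k::comm_ring_1 poly3 \<Rightarrow> 'k poly3 poly" where
  "grading = ev (\<lambda>c. [:const3 c:]) (monom varX 1) (monom varY 1) (monom varZ 1)"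

lemma rhom_cc: "rhom (\<lambda>c. [:const3 c:])"
  by (rule rhom_comp[OF rhom_const rhom_const3])

lemma rhom_grading: "rhom grading"
  unfolding grading_def by (intro rhom_ev rhom_cc)

lemma grading_var [simp]:
  "grading (const3 k) = [:const3 k:]" "grading varX = monom varX 1"
  "grading varY = monom varY 1" "grading varZ = monom varZ 1"
  by (simp_all add: grading_def rhom_cc)

lemma coeff3_coeff_grading:
  "coeff3 (coeff (grading F) n) i j k = (if i + j + k = n then coeff3 F i j k else 0)"
proof (induct F arbitrary: n i j k rule: poly3_induct)
  case (const c) then show ?case by (auto simp: coeff_pCons coeff3_simps split: nat.splits)
next
  case (add F G) then show ?case by (simp add: rhomD[OF rhom_grading] coeff3_simps)
next
  case (X F)
  then show ?case by (cases n; cases i) (auto simp: rhomD[OF rhom_grading] coeff3_simps coeff_monom_mult)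
next
  case (Y F)
  then show ?case by (cases n; cases j) (auto simp: rhomD[OF rhom_grading] coeff3_simps coeff_monom_mult)
next
  case (Z F)
  then show ?case by (cases n; cases k) (auto simp: rhomD[OF rhom_grading] coeff3_simps coeff_monom_mult)
qed

lemma homogeneous3_iff_grading: "homogeneous3 d F \<longleftrightarrow> grading F = monom F d"
proof
  assume h: "homogeneous3 d F"
  show "grading F = monom F d"
  proof (rule poly_eqI, rule poly3_eqI)
    fix n i j k
    show "coeff3 (coeff (grading F) n) i j k = coeff3 (coeff (monom F d) n) i j k"
      using h by (auto simp: coeff3_coeff_grading coeff3_simps homogeneous3_def)
  qed
next
  assume h: "grading F = monom F d"
  show "homogeneous3 d F"
    unfolding homogeneous3_def
  proof (intro allI impI)
    fix i j k assume "coeff3 F i j k \<noteq> 0"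
    then have "coeff3 (coeff (monom F d) (i + j + k)) i j k \<noteq> 0"
      by (simp flip: h add: coeff3_coeff_grading)
    then show "i + j + k = d" by (auto simp: coeff3_simps split: if_splits)
  qed
qed

lemma homogeneous3_mult: "homogeneous3 d F \<Longrightarrow> homogeneous3 e G \<Longrightarrow> homogeneous3 (d + e) (F * G)"
  by (simp add: homogeneous3_iff_grading rhomD[OF rhom_grading] mult_monom)

lemma homogeneous3_add: "homogeneous3 d F \<Longrightarrow> homogeneous3 d G \<Longrightarrow> homogeneous3 d (F + G)"
  by (simp add: homogeneous3_iff_grading rhomD[OF rhom_grading] add_monom)

lemma homogeneous3_diff: "homogeneous3 d F \<Longrightarrow> homogeneous3 d G \<Longrightarrow> homogeneous3 d (F - G)"
  by (simp add: homogeneous3_iff_grading rhomD[OF rhom_grading] diff_monom)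

lemma homogeneous3_power: "homogeneous3 d F \<Longrightarrow> homogeneous3 (d * n) (F ^ n)"
  by (simp add: homogeneous3_iff_grading rhomD[OF rhom_grading] monom_power)

lemma homogeneous3_var: "homogeneous3 1 varX" "homogeneous3 1 varY" "homogeneous3 1 varZ"
  by (simp_all add: homogeneous3_iff_grading)

lemma homogeneous3_const: "homogeneous3 0 (const3 c)"
  by (simp add: homogeneous3_iff_grading monom_0)

lemma homogeneous3_unique: "homogeneous3 d F \<Longrightarrow> homogeneous3 e F \<Longrightarrow> F \<noteq> 0 \<Longrightarrow> d = e"
  by (metis homogeneous3_iff_grading degree_monom_eq)

lemma homogeneous3_0D:
  assumes "homogeneous3 0 F" shows "\<exists>c. F = const3 c"
proof
  show "F = const3 (coeff3 F 0 0 0)"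
    using assms by (intro poly3_eqI) (auto simp: coeff3_simps homogeneous3_def)
qed

lemma homogeneous3_subst3:
  assumes F: "homogeneous3 d F" and a: "homogeneous3 1 a" "homogeneous3 1 b" "homogeneous3 1 c"
  shows "homogeneous3 d (subst3 a b c F)"
proof -
  \<comment> \<open>\<open>?m\<close> applies the substitution to every coefficient of a polynomial
    in the grading variable u.\<close>
  let ?m = "poly_ev (\<lambda>F. [:subst3 a b c F:]) (pCons 0 1)"
  have r: "rhom (\<lambda>F. [:subst3 a b c F:])" by (rule rhom_comp[OF rhom_const rhom_subst3])
  note m = rhom_poly_ev[OF r, of "pCons 0 1"]
  have mm: "?m (monom G n) = monom (subst3 a b c G) n" for G n
    by (induct n) (simp_all add: monom_0 monom_Suc r rhomD[OF rhom_subst3])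
  have "grading (subst3 a b c F) = ev (\<lambda>c. [:const3 c:]) (monom a 1) (monom b 1) (monom c 1) F"
    using a by (subst ev_hom[OF rhom_grading rhom_const3]) (simp add: homogeneous3_iff_grading)
  also have "\<dots> = ?m (grading F)"
    unfolding grading_def by (subst ev_hom[OF m rhom_cc]) (simp add: mm r rhom_const3)
  also have "\<dots> = monom (subst3 a b c F) d"
    using F by (simp add: homogeneous3_iff_grading mm)
  finally show ?thesis by (simp add: homogeneous3_iff_grading)
qed

text \<open>The grading is multiplicative, and when a product of two polynomials in u is a monomial,
  order and degree must agree in both factors.\<close>

lemma homogeneous3_factor:
  fixes F G :: "'k::idom poly3"
  assumes FG: "homogeneous3 n (F * G)" "F * G \<noteq> 0"
  shows "\<exists>d e. homogeneous3 d F \<and> homogeneous3 e G \<and> d + e = n"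
proof -
  let ?f = "grading F" and ?g = "grading G"
  have p: "?f * ?g = monom (F * G) n"
    using FG(1) by (simp add: homogeneous3_iff_grading rhomD[OF rhom_grading])
  have fg: "?f \<noteq> 0" "?g \<noteq> 0" using p FG(2) by (auto simp del: mult_eq_0_iff)
  have mn: "ord0 (monom a m) = m" if "a \<noteq> 0" for a :: "'k poly3" and m
    using that by (simp add: order_0_monom)
  have d: "degree ?f + degree ?g = n"
    using degree_mult_eq[OF fg] p FG(2) by (simp add: degree_monom_eq)
  have o: "ord0 ?f + ord0 ?g = n"
    using order_mult[of ?f ?g 0] p fg FG(2) mn by simp
  have le: "ord0 ?f \<le> degree ?f" "ord0 ?g \<le> degree ?g"
    using fg by (simp_all add: order_degree)
  have eq: "ord0 ?f = degree ?f" "ord0 ?g = degree ?g" using d o le by auto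
  have m: "f = monom (coeff f (degree f)) (degree f)" if "ord0 f = degree f" "f \<noteq> 0" for f :: "'k poly3 poly"
  proof -
    have "coeff f m = 0" if "m < degree f" for m
      using \<open>ord0 f = degree f\<close> that \<open>f \<noteq> 0\<close> by (metis order_1 monom_1_dvd_iff' minus_zero monom_altdef smult_1_left)
    then show ?thesis
      by (intro poly_eqI) (metis coeff_monom coeff_eq_0 linorder_neqE_nat)
  qed
  have h: "homogeneous3 e H" if "grading H = monom c e" for H :: "'k poly3" and c e
    unfolding homogeneous3_def
  proof (intro allI impI)
    fix i j k assume "coeff3 H i j k \<noteq> 0"
    then have "coeff3 (coeff (monom c e) (i + j + k)) i j k \<noteq> 0"
      by (simp flip: that add: coeff3_coeff_grading)
    then show "i + j + k = e" by (auto simp: coeff3_simps split: if_splits)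
  qed
  show ?thesis using h[OF m[OF eq(1) fg(1)]] h[OF m[OF eq(2) fg(2)]] d by blast
qed

subsection \<open>Translation-invariant polynomials\<close>

lemma prod_roots_dvd:
  fixes f :: "'a::idom poly"
  assumes "finite A" "\<And>a. a \<in> A \<Longrightarrow> poly f a = 0"
  shows "(\<Prod>a\<in>A. [:-a, 1:]) dvd f"
  using assms
proof (induct A arbitrary: f rule: finite_induct)
  case (insert a A)
  then obtain g where g: "f = [:-a, 1:] * g"
    by (metis poly_eq_0_iff_dvd dvdE insertI1)
  have "poly g b = 0" if "b \<in> A" for b
    using insert(4)[of b] insert(2) that by (auto simp: g)
  from insert(3)[OF this] show ?case
    unfolding g prod.insert[OF insert(1,2)] by (intro mult_dvd_mono dvd_refl)
qed auto

text \<open>Subtracting its value at 0 makes f vanish on A, hence divisible by N, and the quotient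
  inherits the invariance: f has an N-adic expansion with constant digits. The lemma is stated over
  a domain because A will also be the set F_q * X inside K[X, Y].\<close>

lemma translation_invariant:
  fixes f N :: "'a::idom poly"
  assumes A: "finite A" "A \<noteq> {}" and N: "N = (\<Prod>a\<in>A. [:-a, 1:])"
    and NA: "\<And>a. a \<in> A \<Longrightarrow> pcompose N [:a, 1:] = N"
    and "\<And>a. a \<in> A \<Longrightarrow> pcompose f [:a, 1:] = f"
  shows "\<exists>P. f = pcompose P N"
  using assms(5)
proof (induct "degree f" arbitrary: f rule: less_induct)
  case less
  have dN: "degree N > 0" and N0: "N \<noteq> 0"
    using A by (auto simp: N degree_prod_eq_sum_degree card_gt_0_iff)
  define c where "c = poly f 0"
  have fa: "poly f a = c" if "a \<in> A" for a
    using less(2)[OF that] by (metis c_def poly_pcompose poly_pCons poly_0 mult_zero_left add.right_neutral)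
  then have "N dvd f - [:c:]"
    unfolding N by (intro prod_roots_dvd[OF A(1)]) simp
  then obtain Q where Q: "f - [:c:] = N * Q" ..
  have inv: "pcompose Q [:a, 1:] = Q" if "a \<in> A" for a
  proof -
    have "N * pcompose Q [:a, 1:] = N * Q"
      using less(2)[OF that] by (metis Q NA[OF that] pcompose_diff pcompose_mult pcompose_const)
    then show ?thesis using N0 by simp
  qed
  show ?case
  proof (cases "degree f = 0")
    case True
    then show ?thesis by (metis degree_0_id pcompose_const)
  next
    case False
    then have "f - [:c:] \<noteq> 0" by auto
    then have "Q \<noteq> 0" using Q by auto
    have "degree (f - [:c:]) = degree f"
      using False by (metis degree_pCons_0 degree_add_eq_left degree_minus diff_conv_add_uminus not_gr_zero)
    then have "degree Q < degree f"
      using degree_mult_eq[OF N0 \<open>Q \<noteq> 0\<close>] Q dN by simp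
    from less(1)[OF this inv] obtain P where P: "Q = pcompose P N" by auto
    have "f = pcompose (pCons c P) N"
      using Q by (simp add: pcompose_pCons P algebra_simps)
    then show ?thesis ..
  qed
qed

lemma monic_eq_prod_roots:
  fixes N :: "'a::idom poly"
  assumes "finite A" "lead_coeff N = 1" "degree N = card A" "\<And>a. a \<in> A \<Longrightarrow> poly N a = 0"
  shows "N = (\<Prod>a\<in>A. [:-a, 1:])"
proof -
  let ?M = "\<Prod>a\<in>A. [:-a, 1:]"
  obtain g where g: "N = ?M * g" using prod_roots_dvd[OF assms(1,4)] by (rule dvdE)
  have N0: "N \<noteq> 0" using assms(2) by auto
  have M0: "?M \<noteq> 0" "lead_coeff ?M = 1" using assms(1) by (auto simp: lead_coeff_prod)
  have dM: "degree ?M = card A" by (simp add: degree_prod_eq_sum_degree)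
  have "g \<noteq> 0" using N0 g by auto
  have "degree g = 0"
    using degree_mult_eq[OF M0(1) \<open>g \<noteq> 0\<close>] dM assms(3) g by simp
  moreover have "lead_coeff g = 1"
    using assms(2) M0(2) by (simp add: g lead_coeff_mult)
  ultimately have "g = 1" by (metis degree_0_id one_pCons)
  then show ?thesis using g by simp
qed

section \<open>Order at zero and degree under composition\<close>

lemma degree_diff_left: "degree g < degree f \<Longrightarrow> degree (f - g) = degree f"
  for f g :: "'a::ab_group_add poly"
  using degree_add_eq_left[of "- g" f] by simp

lemma ord0_props:
  fixes f :: "'a::idom poly"
  assumes "f \<noteq> 0"
  shows "coeff f (ord0 f) \<noteq> 0" "k < ord0 f \<Longrightarrow> coeff f k = 0"
proof -
  show 2: "coeff f k = 0" if "k < ord0 f" for k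
    using monom_1_dvd_iff[OF assms, of "ord0 f"] that by (simp add: monom_1_dvd_iff')
  show "coeff f (ord0 f) \<noteq> 0"
  proof
    assume "coeff f (ord0 f) = 0"
    then have "monom 1 (Suc (ord0 f)) dvd f"
      using 2 by (auto simp: monom_1_dvd_iff' less_Suc_eq)
    then show False using monom_1_dvd_iff[OF assms] by simp
  qed
qed

lemma ord0_decomp:
  fixes f :: "'a::idom poly"
  assumes "f \<noteq> 0"
  obtains g where "f = monom 1 (ord0 f) * g" "poly g 0 \<noteq> 0"
proof -
  obtain g where g: "f = [:- 0, 1:] ^ ord0 f * g" "\<not> [:- 0, 1:] dvd g"
    using order_decomp[OF assms, of 0] by blast
  have "f = monom 1 (ord0 f) * g" using g(1) by (simp add: monom_altdef)
  moreover have "poly g 0 \<noteq> 0" using g(2) by (simp add: poly_eq_0_iff_dvd)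
  ultimately show thesis by (rule that)
qed

lemma ord0_pcompose:
  fixes P N :: "'a::idom poly"
  assumes "P \<noteq> 0" "poly N 0 = 0" "N \<noteq> 0"
  shows "ord0 (pcompose P N) = ord0 P * ord0 N"
proof -
  obtain g where g: "P = monom 1 (ord0 P) * g" "poly g 0 \<noteq> 0" using ord0_decomp[OF assms(1)] .
  have m: "pcompose (monom 1 k) N = N ^ k" for k
    by (induct k) (simp_all add: monom_Suc pcompose_pCons pcompose_1)
  have e: "pcompose P N = N ^ ord0 P * pcompose g N"
    by (subst g(1)) (simp add: pcompose_mult m)
  have g0: "poly (pcompose g N) 0 \<noteq> 0" using g(2) assms(2) by (simp add: poly_pcompose)
  then have "ord0 (pcompose g N) = 0" by (simp add: order_0I)
  moreover have "ord0 (N ^ k) = k * ord0 N" for k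
    using assms(3) by (induct k) (simp_all add: order_mult)
  moreover have "N ^ ord0 P * pcompose g N \<noteq> 0" using assms(3) g0 by auto
  ultimately show ?thesis unfolding e by (simp add: order_mult)
qed

lemma ord0_ge_cancel:
  fixes F A :: "'a::idom poly"
  assumes "monom 1 n dvd F * A" "poly A 0 \<noteq> 0"
  shows "monom 1 n dvd F"
proof (cases "F = 0")
  case False
  moreover have "A \<noteq> 0" using assms(2) by auto
  ultimately show ?thesis
    using assms by (simp add: monom_1_dvd_iff order_mult order_0I)
qed auto

lemma pcompose_inject:
  fixes f g N :: "'a::idom poly"
  assumes "degree N > 0" "pcompose f N = pcompose g N"
  shows "f = g"
  using pcompose_eq_0[of "f - g" N] assms by (simp add: pcompose_diff)

text \<open>A root of the quotient of f by all its linear factors would be a double root of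
  f.\<close>

lemma card_roots_separable:
  fixes f :: "'a::field poly"
  assumes ac: "\<And>g :: 'a poly. degree g \<ge> 1 \<Longrightarrow> \<exists>x. poly g x = 0"
    and f: "f \<noteq> 0" "\<And>x. poly f x = 0 \<Longrightarrow> poly (pderiv f) x \<noteq> 0"
  shows "card {x. poly f x = 0} = degree f"
proof -
  define A where "A = {x. poly f x = 0}"
  let ?M = "\<Prod>a\<in>A. [:-a, 1:]"
  have fin: "finite A" unfolding A_def using f(1) by (rule poly_roots_finite)
  have "?M dvd f" by (rule prod_roots_dvd[OF fin]) (simp add: A_def)
  then obtain g where g: "f = ?M * g" ..
  have "degree g = 0"
  proof (rule ccontr)
    assume "degree g \<noteq> 0"
    then obtain b where b: "poly g b = 0" using ac[of g] by auto
    then have "poly f b = 0" by (simp add: g)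
    then have "poly ?M b = 0" using fin by (auto simp: poly_prod A_def)
    then have "poly (pderiv f) b = 0"
      using b by (simp add: g pderiv_mult)
    then show False using f(2) \<open>poly f b = 0\<close> by blast
  qed
  moreover have "g \<noteq> 0" "?M \<noteq> 0" using f(1) g by auto
  ultimately have "degree f = card A"
    using degree_mult_eq[of ?M g] g by (simp add: degree_prod_eq_sum_degree)
  then show ?thesis by (simp add: A_def)
qed

section \<open>Frobenius, the subfield F_q and its translations\<close>

locale closed_field =
  fixes p q n :: nat and K :: "'k::field itself"
  assumes p: "prime p" and n: "n \<ge> 1" and q: "q = p ^ n"
    and char: "CHAR('k) = p"
    and alg_closed: "\<And>P :: 'k poly. degree P \<ge> 1 \<Longrightarrow> \<exists>x. poly P x = 0"
begin

lemma q2: "q \<ge> 2"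
proof -
  have "p \<ge> 2" using p by (rule prime_ge_2_nat)
  also have "p = p ^ 1" by simp
  also have "p ^ 1 \<le> q" unfolding q using n prime_gt_0_nat[OF p] by (intro power_increasing) auto
  finally show ?thesis .
qed

text \<open>Stated over any commutative ring of characteristic p, since it is applied in K and in
  every layer of K[X][Y][Z].\<close>

lemma frobenius:
  fixes x y :: "'r::comm_ring_1"
  assumes "CHAR('r) = p"
  shows "(x + y) ^ (q ^ m) = x ^ (q ^ m) + y ^ (q ^ m)"
    "(x - y) ^ (q ^ m) = x ^ (q ^ m) - y ^ (q ^ m)"
    "(- x) ^ (q ^ m) = - (x ^ (q ^ m))"
proof -
  show 1: "(x + y) ^ (q ^ m) = x ^ (q ^ m) + y ^ (q ^ m)" for x y :: 'r
    by (rule freshmans_dream'[of _ "n * m"]) (use p in \<open>auto simp: assms q power_mult\<close>)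
  show 2: "(x - y) ^ (q ^ m) = x ^ (q ^ m) - y ^ (q ^ m)" for x y :: 'r
    using 1[of "x - y" y] by simp
  show "(- x) ^ (q ^ m) = - (x ^ (q ^ m))"
    using 2[of 0 x] q2 by (simp add: zero_power)
qed

lemmas frobenius1 = frobenius[where m = 1, simplified power_one_right]

lemma chars: "CHAR('k poly) = p" "CHAR('k poly poly) = p" "CHAR('k poly poly poly) = p" "CHAR('k) = p"
  by (simp_all add: char)

lemma of_nat_q: "of_nat q = (0 :: 'k)"
  using n by (simp add: of_nat_eq_0_iff_char_dvd char q dvd_power)

definition Fq :: "'k set" where "Fq = {a. a ^ q = a}"

lemma card_roots_frob:
  assumes "m \<ge> 1"
  shows "card {a :: 'k. a ^ (q ^ m) = a} = q ^ m"
proof -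
  let ?f = "monom 1 (q ^ m) - monom 1 1 :: 'k poly"
  have 1: "1 < q ^ m" using q2 assms by (intro one_less_power) auto
  have d: "degree ?f = q ^ m"
    using 1 by (subst degree_diff_left) (auto simp: degree_monom_eq)
  have m0: "of_nat (q ^ m) = (0 :: 'k)"
    using assms by (simp add: of_nat_q)
  have "pderiv ?f = - 1"
    using m0 by (simp add: pderiv_diff pderiv_monom monom_0)
  moreover have "?f \<noteq> 0"
  proof
    assume "?f = 0"
    then have "degree ?f = 0" by (simp only: degree_0)
    from this[unfolded d] show False using q2 by simp
  qed
  ultimately have "card {x. poly ?f x = 0} = q ^ m"
    using card_roots_separable[OF alg_closed, of ?f] d by simp
  then show ?thesis by (simp add: poly_monom)
qed

lemma card_Fq: "card Fq = q"
  using card_roots_frob[of 1] by (simp add: Fq_def)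

lemma finite_Fq: "finite Fq"
  using card_Fq q2 by (intro card_ge_0_finite) simp

lemma Fq_closed [simp]:
  "0 \<in> Fq" "1 \<in> Fq" "a \<in> Fq \<Longrightarrow> b \<in> Fq \<Longrightarrow> a + b \<in> Fq" "a \<in> Fq \<Longrightarrow> - a \<in> Fq"
  "a \<in> Fq \<Longrightarrow> b \<in> Fq \<Longrightarrow> a * b \<in> Fq" "a \<in> Fq \<Longrightarrow> inverse a \<in> Fq"
  using q2 by (auto simp: Fq_def frobenius1[OF char] power_mult_distrib power_inverse)

text \<open>All q - 1 nonzero elements of F_q would be roots of T^r - 1 with r = k mod (q - 1), too
  many unless r = 0.\<close>

lemma exponent_dvd:
  assumes "\<And>a. a \<in> Fq \<Longrightarrow> a \<noteq> 0 \<Longrightarrow> a ^ k = 1"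
  shows "(q - 1) dvd k"
proof -
  define r where "r = k mod (q - 1)"
  have r: "a ^ r = 1" if "a \<in> Fq" "a \<noteq> 0" for a
  proof -
    have "a ^ (q - 1) * a = a" using that q2 by (simp add: Fq_def flip: power_Suc2)
    then have 1: "a ^ (q - 1) = 1" using that by simp
    have "k = (q - 1) * (k div (q - 1)) + r" by (simp add: r_def)
    then have "a ^ k = (a ^ (q - 1)) ^ (k div (q - 1)) * a ^ r" by (metis power_add power_mult)
    then show ?thesis using assms[OF that] 1 by simp
  qed
  have "r = 0"
  proof (rule ccontr)
    assume r0: "r \<noteq> 0"
    let ?f = "monom 1 r - 1 :: 'k poly"
    have d: "degree ?f = r" using r0 by (subst degree_diff_left) (auto simp: degree_monom_eq)
    have "?f \<noteq> 0" using d r0 by auto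
    have "card (Fq - {0}) \<le> card {x. poly ?f x = 0}"
      using r by (intro card_mono poly_roots_finite[OF \<open>?f \<noteq> 0\<close>]) (auto simp: poly_monom)
    also have "\<dots> \<le> r" using card_poly_roots_bound[OF \<open>?f \<noteq> 0\<close>] d by simp
    finally have "q - 1 \<le> r" using card_Fq finite_Fq by simp
    moreover have "r < q - 1" using q2 unfolding r_def by simp
    ultimately show False by simp
  qed
  then show ?thesis by (auto simp: r_def)
qed

lemma Fq_invariant:
  fixes f :: "'k poly"
  assumes "\<And>a. a \<in> Fq \<Longrightarrow> pcompose f [:a, 1:] = f"
  shows "\<exists>P. f = pcompose P (monom 1 q - monom 1 1)"
proof -
  let ?N = "monom 1 q - monom 1 1 :: 'k poly"
  have d: "degree ?N = q"
    using q2 by (subst degree_diff_left) (auto simp: degree_monom_eq)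
  have "?N = (\<Prod>a\<in>Fq. [:-a, 1:])"
  proof (rule monic_eq_prod_roots[OF finite_Fq])
    show "lead_coeff ?N = 1" unfolding d using q2 by simp
    show "degree ?N = card Fq" unfolding d card_Fq ..
    show "poly ?N a = 0" if "a \<in> Fq" for a
      using that by (simp add: poly_monom Fq_def)
  qed
  moreover have "pcompose ?N [:a, 1:] = ?N" if "a \<in> Fq" for a
  proof -
    have m: "pcompose (monom 1 k) g = g ^ k" for k and g :: "'k poly"
      by (induct k) (simp_all add: monom_Suc pcompose_pCons pcompose_1)
    have e: "[:a, 1:] = monom 1 1 + [:a:]" by (simp add: monom_Suc monom_0)
    have "[:a, 1:] ^ q = monom 1 1 ^ q + [:a:] ^ q" unfolding e by (rule frobenius1(1)[OF chars(1)])
    also have "\<dots> = monom 1 q + [:a:]" using that by (simp add: monom_power poly_const_pow Fq_def)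
    finally show ?thesis by (simp add: pcompose_diff m monom_Suc[of _ 0] monom_0)
  qed
  ultimately show ?thesis
    using card_Fq q2 by (intro translation_invariant[OF finite_Fq _ _ _ assms]) auto
qed

end

subsection \<open>Degrees of invariants\<close>

definition indet :: "'a::comm_ring_1 poly" where "indet = [:0, 1:]"

lemma pcompose_indet [simp]: "pcompose f indet = f" "pcompose indet f = f"
proof -
  show "pcompose f indet = f" unfolding indet_def by (rule pcompose_idR)
  show "pcompose indet f = f" by (simp add: indet_def pcompose_pCons)
qed

lemma indet_power: "indet ^ k = monom 1 k"
  by (induct k) (simp_all add: indet_def monom_Suc)

lemma pcompose_power: "pcompose (f ^ k) g = pcompose f g ^ k"
  by (induct k) (simp_all add: pcompose_1 pcompose_mult)

lemma pcompose_monom: "pcompose (monom 1 k) f = f ^ k" for f :: "'a::comm_ring_1 poly"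
  by (simp flip: indet_power add: pcompose_power)

lemma rhom_pcompose: "rhom (\<lambda>f. pcompose f g)"
  by (simp add: rhom_def pcompose_add pcompose_mult pcompose_1)

text \<open>F(0, 1, T): the restriction of the curve to the line X = 0.\<close>
definition aff :: "'k::comm_ring_1 poly3 \<Rightarrow> 'k poly" where
  "aff = ev (\<lambda>c. [:c:]) 0 1 indet"

lemma rhom_aff: "rhom aff"
  unfolding aff_def by (intro rhom_ev rhom_const)

lemmas aff_simps [simp] = rhomD[OF rhom_aff]

lemma aff_var [simp]: "aff varX = 0" "aff varY = 1" "aff varZ = indet" "aff (const3 c) = [:c:]"
  by (simp_all add: aff_def rhom_const)

lemma aff_subst3: "aff (subst3 A B C F) = ev (\<lambda>c. [:c:]) (aff A) (aff B) (aff C) F"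
  by (simp add: aff_def ev_subst3 rhom_const)

lemma pcompose_aff: "pcompose (aff F) g = ev (\<lambda>c. [:c:]) 0 1 g F"
  unfolding aff_def
  by (subst ev_hom[OF rhom_pcompose rhom_const]) (simp add: pcompose_1)

lemma rhom_coeff_0: "rhom (\<lambda>f. coeff f 0)"
  by (simp add: rhom_def coeff_mult)

lemma coeff_aff: "coeff (aff F) k = poly_ev (\<lambda>H. coeff H 0) 1 (coeff F k)"
proof -
  note [simp] = rhomD[OF rhom_poly_ev[OF rhom_coeff_0, of 1]] rhom_coeff_0
  show ?thesis
  proof (induct F arbitrary: k rule: poly3_induct)
    case (const c)
    show ?case unfolding aff_var by (simp add: const3_def coeff_pCons split: nat.splits)
  next
    case (add F G)
    then show ?case by simp
  next
    case (X F)
    have "aff (varX * F) = 0" by simp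
    moreover have "coeff (varX * F) k = [:[:0, 1:]:] * coeff F k" by (simp add: varX_def)
    moreover have "poly_ev (\<lambda>H. coeff H 0) 1 ([:[:0, 1:]:] * coeff F k) = 0"
      unfolding rhomD(4)[OF rhom_poly_ev[OF rhom_coeff_0, of 1]] by simp
    ultimately show ?case by simp
  next
    case (Y F)
    have "aff (varY * F) = aff F" by simp
    then show ?case by (simp only: Y) (simp add: varY_def)
  next
    case (Z F)
    have "aff (varZ * F) = indet * aff F" by simp
    then show ?case using Z by (simp only:) (simp add: varZ_def indet_def coeff_pCons split: nat.splits)
  qed
qed

text \<open>A form in Y and Z alone is determined by its dehomogenisation at Y = 1, so
  \<open>aff F\<close> retains all of F(0, Y, Z).\<close>

lemma coeff_aff_homogeneous:
  assumes "homogeneous3 d F"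
  shows "coeff (aff F) k = (if k \<le> d then coeff3 F 0 (d - k) k else 0)"
proof -
  let ?G = "map_poly (\<lambda>H. coeff H 0) (coeff F k)"
  have c: "coeff ?G j = coeff3 F 0 j k" for j
    by (simp add: coeff_map_poly coeff3_def)
  have z: "coeff3 F 0 j k = 0" if "j + k \<noteq> d" for j
    using assms that unfolding homogeneous3_def by (metis add_0)
  have "?G = monom (if k \<le> d then coeff3 F 0 (d - k) k else 0) (d - k)"
    by (rule poly_eqI) (auto simp: c z)
  then show ?thesis by (simp add: coeff_aff poly_ev_def poly_monom)
qed

lemma varX_dvd_iff:
  assumes "homogeneous3 d F"
  shows "varX dvd F \<longleftrightarrow> aff F = 0"
proof
  assume "varX dvd F" then show "aff F = 0" by (auto elim!: dvdE)
next
  assume f: "aff F = 0"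
  have "\<exists>G F0. F = varX * G + F0 \<and> (\<forall>i j k. i > 0 \<longrightarrow> coeff3 F0 i j k = 0)"
  proof (induct F rule: poly3_induct)
    case (const c)
    show ?case by (intro exI[of _ 0] exI[of _ "const3 c"]) (simp add: coeff3_simps)
  next
    case (add F G)
    then obtain F1 F0 G1 G0 where "F = varX * F1 + F0" "\<forall>i j k. i > 0 \<longrightarrow> coeff3 F0 i j k = 0"
      "G = varX * G1 + G0" "\<forall>i j k. i > 0 \<longrightarrow> coeff3 G0 i j k = 0" by blast
    then show ?case
      by (intro exI[of _ "F1 + G1"] exI[of _ "F0 + G0"]) (simp add: coeff3_simps algebra_simps)
  next
    case (X F)
    show ?case by (intro exI[of _ F] exI[of _ 0]) (simp add: coeff3_simps)
  next
    case (Y F)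
    then obtain F1 F0 where "F = varX * F1 + F0" "\<forall>i j k. i > 0 \<longrightarrow> coeff3 F0 i j k = 0" by blast
    then show ?case
      by (intro exI[of _ "varY * F1"] exI[of _ "varY * F0"]) (simp add: coeff3_simps algebra_simps)
  next
    case (Z F)
    then obtain F1 F0 where "F = varX * F1 + F0" "\<forall>i j k. i > 0 \<longrightarrow> coeff3 F0 i j k = 0" by blast
    then show ?case
      by (intro exI[of _ "varZ * F1"] exI[of _ "varZ * F0"]) (simp add: coeff3_simps algebra_simps)
  qed
  then obtain G F0 where G: "F = varX * G + F0" "\<forall>i j k. i > 0 \<longrightarrow> coeff3 F0 i j k = 0" by blast
  have 0: "coeff3 F 0 j k = 0" for j k
  proof (cases "j + k = d")
    case True
    then show ?thesis using coeff_aff_homogeneous[OF assms, of k] f by auto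
  next
    case False
    then show ?thesis using assms unfolding homogeneous3_def by (metis add_0)
  qed
  have "F0 = 0"
  proof (rule poly3_eqI)
    fix i j k
    have "coeff3 F 0 j k = coeff3 F0 0 j k" by (simp add: G(1) coeff3_simps)
    then show "coeff3 F0 i j k = coeff3 0 i j k"
      using G(2) 0 by (cases "i = 0") (auto simp: coeff3_simps)
  qed
  then show "varX dvd F" using G(1) by simp
qed

lemma degree_aff_le:
  assumes "homogeneous3 d F" shows "degree (aff F) \<le> d"
  using coeff_aff_homogeneous[OF assms] by (intro degree_le) auto

lemma coeff3_swap_YZ: "coeff3 (subst3 varX varZ varY F) i j k = coeff3 F i k j"
  by (induct F arbitrary: i j k rule: poly3_induct)
    (auto simp: coeff3_simps rhomD[OF rhom_subst3] rhom_const3)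

text \<open>The rotation Y -> -Z, Z -> Y turns the coefficient of T^k into that of T^(d - k) up to
  sign, so the support of \<open>aff F\<close> is symmetric under k -> d - k.\<close>

lemma ord0_plus_degree_aff:
  fixes F :: "'k::idom poly3"
  assumes h: "homogeneous3 d F" and w: "subst3 varX (- varZ) varY F = F" and f: "aff F \<noteq> 0"
  shows "ord0 (aff F) + degree (aff F) = d"
proof -
  let ?f = "aff F" and ?G = "subst3 varX varZ varY F"
  have hG: "homogeneous3 d ?G" by (intro homogeneous3_subst3 h homogeneous3_var)
  have "?f = ev (\<lambda>c. [:c:]) 0 (- indet) 1 F"
    by (subst w[symmetric]) (simp add: aff_subst3)
  also have "\<dots> = pcompose (aff ?G) (- indet)"
    by (simp add: pcompose_aff ev_subst3 rhom_const)
  finally have fG: "?f = pcompose (aff ?G) (- indet)" .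
  have c: "coeff ?f k = (- 1) ^ k * coeff (aff ?G) k" for k
  proof -
    have m: "- indet = [:0, -1 :: 'k:]" by (intro poly_eqI) (simp add: indet_def coeff_pCons split: nat.splits)
    show ?thesis by (subst fG, subst m, subst coeff_pcompose_linear) simp
  qed
  have r: "coeff ?f k = (- 1) ^ k * coeff ?f (d - k)" if "k \<le> d" for k
  proof -
    have "coeff (aff ?G) k = coeff ?f (d - k)"
      unfolding coeff_aff_homogeneous[OF hG] coeff_aff_homogeneous[OF h] using that
      by (simp add: coeff3_swap_YZ)
    then show ?thesis by (simp add: c[of k])
  qed
  have le: "degree ?f \<le> d" by (rule degree_aff_le[OF h])
  have "ord0 ?f \<le> degree ?f" using f by (rule order_degree)
  have "coeff ?f (d - degree ?f) \<noteq> 0" using r[OF le] f by auto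
  then have "ord0 ?f \<le> d - degree ?f" using ord0_props(2)[OF f] by (meson not_le)
  moreover have "coeff ?f (d - ord0 ?f) \<noteq> 0"
    using r[of "ord0 ?f"] ord0_props(1)[OF f] \<open>ord0 ?f \<le> degree ?f\<close> le by auto
  then have "d - ord0 ?f \<le> degree ?f" by (rule le_degree)
  ultimately show ?thesis using le by simp
qed

section \<open>Elations, Weyl elements and the torus of SL(3,q)\<close>

context closed_field
begin

text \<open>Four root subgroups of SL(3,q); the two letters name the variable that is shifted and
  the one that is added. The opposite pair zy, yz generates the Weyl element exchanging Y and Z; the
  pair zx, xz generates the one exchanging X and Z, and a torus.\<close>

definition inv_zx where
  "inv_zx F \<longleftrightarrow> (\<forall>a\<in>Fq. subst3 varX varY (varZ + const3 a * varX) F = F)"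
definition inv_zy where
  "inv_zy F \<longleftrightarrow> (\<forall>a\<in>Fq. subst3 varX varY (varZ + const3 a * varY) F = F)"
definition inv_yz where
  "inv_yz F \<longleftrightarrow> (\<forall>a\<in>Fq. subst3 varX (varY + const3 a * varZ) varZ F = F)"
definition inv_xz where
  "inv_xz F \<longleftrightarrow> (\<forall>a\<in>Fq. subst3 (varX + const3 a * varZ) varY varZ F = F)"

lemma power_q: "x ^ q = x ^ (q - 1) * x" for x :: "'r::comm_ring_1"
  using q2 by (metis Suc_diff_1 power_Suc2 less_le_trans pos2)

text \<open>The product of Z - a*X over all a in F_q. On X = 0 it becomes T^q, which is the source
  of the factor q in all exponents of \<open>aff F\<close>.\<close>

definition NZ :: "'k poly3" where "NZ = varZ ^ q - varX ^ (q - 1) * varZ"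

lemma NZ_eq: "NZ = monom 1 q - monom ([:[:0, 1:]:] ^ (q - 1)) 1"
  by (simp add: NZ_def varZ_def varX_def monom_altdef flip: poly_const_pow)

lemma inv_zx_structure:
  assumes "inv_zx F"
  shows "\<exists>P. F = pcompose P NZ"
proof -
  let ?x = "[:[:0, 1:]:] :: 'k poly poly"
  \<comment> \<open>The translations are by the elements of F_q * X, which are constants for the
    outer variable Z.\<close>
  let ?A = "(\<lambda>a. [:[:0, a:]:]) ` Fq"
  have inj: "inj_on (\<lambda>a. [:[:0, a:]:]) Fq" by (simp add: inj_on_def)
  have d: "degree NZ = q"
  proof -
    have "degree (monom (?x ^ (q - 1)) 1) < q"
      using degree_monom_le[of "?x ^ (q - 1)" 1] q2 by linarith
    moreover have m: "degree (monom (1 :: 'k poly poly) q) = q" by (rule degree_monom_eq) simp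
    ultimately have "degree NZ = degree (monom (1 :: 'k poly poly) q)"
      unfolding NZ_eq by (intro degree_diff_left) (simp only: m)
    then show ?thesis unfolding m .
  qed
  have pow: "[:[:0, a:]:] ^ q = ?x ^ (q - 1) * [:[:0, a:]:]" if "a \<in> Fq" for a
  proof -
    have e: "[:[:0, a:]:] = ?x * [:[:a:]:]" by simp
    have "[:[:0, a:]:] ^ q = ?x ^ q * [:[:a:]:] ^ q" unfolding e by (rule power_mult_distrib)
    also have "[:[:a:]:] ^ q = [:[:a:]:]" using that by (simp add: poly_const_pow Fq_def)
    also have "?x ^ q = ?x ^ (q - 1) * ?x" by (rule power_q)
    finally show ?thesis unfolding e by (simp only: mult.assoc)
  qed
  have "NZ = (\<Prod>a\<in>?A. [:-a, 1:])"
  proof (rule monic_eq_prod_roots)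
    show "finite ?A" using finite_Fq by simp
    show "lead_coeff NZ = 1" unfolding d unfolding NZ_eq using q2 by simp
    show "degree NZ = card ?A" unfolding d card_image[OF inj] card_Fq ..
    show "poly NZ \<alpha> = 0" if al: "\<alpha> \<in> ?A" for \<alpha>
    proof -
      obtain a where a: "a \<in> Fq" "\<alpha> = [:[:0, a:]:]" using al by blast
      show ?thesis unfolding NZ_eq a(2) poly_diff poly_monom pow[OF a(1)] by simp
    qed
  qed
  moreover have "pcompose NZ [:\<alpha>, 1:] = NZ" if al: "\<alpha> \<in> ?A" for \<alpha>
  proof -
    obtain a where a: "a \<in> Fq" "\<alpha> = [:[:0, a:]:]" using al by blast
    have c: "const3 a * varX = [:\<alpha>:]" by (simp add: a const3_def varX_def)
    have W: "[:\<alpha>, 1:] = varZ + const3 a * varX" unfolding c by (simp add: varZ_def)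
    have aq: "const3 a ^ q = const3 a" using a(1) by (simp add: Fq_def flip: const3_simps)
    have xq: "varX ^ q = varX ^ (q - 1) * varX" by (rule power_q)
    show ?thesis unfolding W subst3_Z[symmetric] NZ_def
      by (simp add: rhomD[OF rhom_subst3] rhom_const3 frobenius1[OF chars(3)] power_mult_distrib aq xq algebra_simps)
  qed
  moreover have "pcompose F [:\<alpha>, 1:] = F" if al: "\<alpha> \<in> ?A" for \<alpha>
  proof -
    obtain a where a: "a \<in> Fq" "\<alpha> = [:[:0, a:]:]" using al by blast
    have c: "const3 a * varX = [:\<alpha>:]" by (simp add: a const3_def varX_def)
    have W: "[:\<alpha>, 1:] = varZ + const3 a * varX" unfolding c by (simp add: varZ_def)
    show ?thesis unfolding W subst3_Z[symmetric] using assms a(1) by (simp add: inv_zx_def)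
  qed
  moreover have "finite ?A" "?A \<noteq> {}" using finite_Fq Fq_closed(1) by blast+
  ultimately show ?thesis by (intro translation_invariant[of ?A])
qed

lemma aff_pcompose_NZ: "aff (pcompose P NZ) = pcompose (aff P) (monom 1 q)"
proof -
  have "aff NZ = monom 1 q" using q2 by (simp add: NZ_def indet_power zero_power)
  then show ?thesis by (simp flip: subst3_Z add: aff_subst3 pcompose_aff)
qed

text \<open>The familiar product of three elations, with parameters 1, -1, 1.\<close>

lemma weyl_yz:
  assumes "inv_zy F" "inv_yz F"
  shows "subst3 varX (- varZ) varY F = F"
proof -
  let ?U = "\<lambda>F. subst3 varX varY (varZ + varY) F" and ?V = "\<lambda>F. subst3 varX (varY - varZ) varZ F"
  have U: "?U F = F" using assms(1)[unfolded inv_zy_def, rule_format, of 1] by (simp add: const3_simps)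
  have V: "?V F = F" using assms(2)[unfolded inv_yz_def, rule_format, of "- 1"] by (simp add: const3_simps)
  have "F = ?U (?V (?U F))" by (simp add: U V)
  also have "\<dots> = subst3 varX (- varZ) varY F"
    by (simp add: ev_subst3 rhom_const3 rhomD[OF rhom_subst3])
  finally show ?thesis by simp
qed

text \<open>The same product with parameters a, -1/a, a. The free parameter yields the torus by
  combining two of these elements.\<close>

lemma weyl_xz:
  assumes "inv_zx F" "inv_xz F" and a: "a \<in> Fq" "a \<noteq> 0"
  shows "subst3 (- const3 (inverse a) * varZ) varY (const3 a * varX) F = F"
proof -
  let ?b = "- inverse a"
  let ?U = "\<lambda>F. subst3 varX varY (varZ + const3 a * varX) F"
  let ?V = "\<lambda>F. subst3 (varX + const3 ?b * varZ) varY varZ F"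
  have U: "?U F = F" using assms(1) a by (simp add: inv_zx_def)
  have V: "?V F = F" using assms(2) a by (simp add: inv_xz_def)
  have i: "const3 a * const3 (inverse a) = 1" using a by (simp flip: const3_simps)
  have *: "const3 (inverse a) * (const3 a * x) = x" "const3 a * (const3 (inverse a) * x) = x" for x
    using i by (simp_all flip: mult.assoc) (simp add: mult.commute)
  have e1: "varX + const3 ?b * (varZ + const3 a * varX) = - const3 (inverse a) * varZ"
    unfolding const3_simps by (simp add: distrib_left *)
  have e2: "varZ + const3 a * varX + const3 a * (- const3 (inverse a) * varZ) = const3 a * varX"
    by (simp add: *)
  have "F = ?U (?V (?U F))" by (simp add: U V)
  also have "\<dots> = subst3 (varX + const3 ?b * (varZ + const3 a * varX)) varY
      (varZ + const3 a * varX + const3 a * (varX + const3 ?b * (varZ + const3 a * varX))) F"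
    by (simp add: ev_subst3 rhom_const3 rhomD[OF rhom_subst3])
  also have "\<dots> = subst3 (- const3 (inverse a) * varZ) varY (const3 a * varX) F"
    unfolding e1 e2 ..
  finally show ?thesis by simp
qed

text \<open>The Weyl elements with parameters a and -1 multiply to the diagonal element with entries
  1/a, 1, a.\<close>

lemma torus_xz:
  assumes "inv_zx F" "inv_xz F" and a: "a \<in> Fq" "a \<noteq> 0"
  shows "subst3 (const3 (inverse a) * varX) varY (const3 a * varZ) F = F"
proof -
  have 1: "subst3 varZ varY (- varX) F = F"
    using weyl_xz[OF assms(1,2), of "- 1"] by (simp add: const3_simps)
  have "F = subst3 varZ varY (- varX) (subst3 (- const3 (inverse a) * varZ) varY (const3 a * varX) F)"
    using weyl_xz[OF assms] by (simp add: 1)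
  also have "\<dots> = subst3 (const3 (inverse a) * varX) varY (const3 a * varZ) F"
    by (simp add: ev_subst3 rhom_const3 rhomD[OF rhom_subst3])
  finally show ?thesis by simp
qed

lemma monom_q_props: "degree (monom 1 q :: 'k poly) = q" "ord0 (monom 1 q :: 'k poly) = q"
  by (simp_all add: degree_monom_eq)

text \<open>Here F(0, 1, T) = R(T^q - T) with T replaced by T^q, e = ord R and u = deg R.\<close>
lemma shape:
  assumes h: "homogeneous3 d F" and f: "aff F \<noteq> 0"
    and inv: "inv_zx F" "inv_zy F" "inv_yz F"
  shows "\<exists>e u. e \<le> u \<and> d = q * (e + q * u) \<and> ord0 (aff F) = q * e \<and> degree (aff F) = q * (q * u)"
proof -
  let ?f = "aff F" and ?N = "monom 1 q - monom 1 1 :: 'k poly"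
  obtain P where "F = pcompose P NZ" using inv_zx_structure[OF inv(1)] by blast
  define g where "g = aff P"
  have fg: "?f = pcompose g (monom 1 q)"
    unfolding g_def by (subst \<open>F = pcompose P NZ\<close>) (rule aff_pcompose_NZ)
  have "pcompose g [:a, 1:] = g" if a: "a \<in> Fq" for a
  proof -
    have fa: "pcompose ?f [:a, 1:] = ?f"
    proof -
      have "?f = aff (subst3 varX varY (varZ + const3 a * varY) F)"
        using inv(2) a by (simp add: inv_zy_def)
      also have "\<dots> = pcompose ?f (indet + [:a:])"
        by (simp add: aff_subst3 pcompose_aff)
      also have "indet + [:a:] = [:a, 1:]" by (simp add: indet_def)
      finally show ?thesis by simp
    qed
    have e: "[:a, 1:] = indet + [:a:]" by (simp add: indet_def)
    \<comment> \<open>Since a^q = a, the q-th power commutes with the translation by a; cancelling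
      the composition with T^q passes the invariance on to g.\<close>
    have "pcompose (monom 1 q) [:a, 1:] = (indet + [:a:]) ^ q"
      unfolding pcompose_monom e ..
    also have "\<dots> = indet ^ q + [:a:] ^ q" by (rule frobenius1(1)[OF chars(1)])
    also have "\<dots> = monom 1 q + [:a:]" using a by (simp add: indet_power poly_const_pow Fq_def)
    also have "\<dots> = pcompose [:a, 1:] (monom 1 q)" by (simp add: pcompose_pCons pcompose_1)
    finally have *: "pcompose (pcompose g [:a, 1:]) (monom 1 q) = pcompose g (monom 1 q)"
      using fa unfolding fg by (metis pcompose_assoc)
    have "degree (monom (1 :: 'k) q) > 0" unfolding monom_q_props using q2 by simp
    from pcompose_inject[OF this *] show ?thesis .
  qed
  then obtain R where R: "g = pcompose R ?N" using Fq_invariant by blast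
  have N: "degree ?N = q" "ord0 ?N = 1" "?N \<noteq> 0" "poly ?N 0 = 0"
  proof -
    show dN: "degree ?N = q"
      using q2 by (subst degree_diff_left) (auto simp: degree_monom_eq)
    show N0: "?N \<noteq> 0"
    proof
      assume "?N = 0"
      then have "degree ?N = 0" by (simp only: degree_0)
      from this[unfolded dN] show False using q2 by simp
    qed
    show "poly ?N 0 = 0" using q2 by (simp add: poly_monom)
    \<comment> \<open>T^q - T has a simple zero at 0, so g = R(T^q - T) has the order of R but q
      times its degree. This asymmetry produces e + q*u.\<close>
    have eN: "?N = monom 1 1 * (monom 1 (q - 1) - 1)"
      using q2 by (simp add: right_diff_distrib mult_monom)
    have u: "poly (monom 1 (q - 1) - 1) 0 = (- 1 :: 'k)" using q2 by (simp add: poly_monom)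
    have "ord0 (monom 1 1 * (monom 1 (q - 1) - 1) :: 'k poly) = 1"
    proof (subst order_mult)
      show "monom 1 1 * (monom 1 (q - 1) - 1 :: 'k poly) \<noteq> 0" using N0 unfolding eN .
      have "ord0 (monom 1 (q - 1) - 1 :: 'k poly) = 0" using u by (intro order_0I) simp
      then show "ord0 (monom 1 1 :: 'k poly) + ord0 (monom 1 (q - 1) - 1 :: 'k poly) = 1" by simp
    qed
    then show "ord0 ?N = 1" unfolding eN .
  qed
  have g0: "g \<noteq> 0" using f fg by auto
  then have R0: "R \<noteq> 0" using R by auto
  have og: "ord0 g = ord0 R" unfolding R ord0_pcompose[OF R0 N(4,3)] N(2) by simp
  have dg: "degree g = degree R * q" unfolding R degree_pcompose N(1) ..
  have m: "poly (monom 1 q) 0 = (0 :: 'k)" "monom 1 q \<noteq> (0 :: 'k poly)"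
    using q2 by (auto simp: poly_monom)
  have ofx: "ord0 ?f = q * ord0 R"
    unfolding fg ord0_pcompose[OF g0 m] og monom_q_props by simp
  have dfx: "degree ?f = q * (q * degree R)"
    unfolding fg degree_pcompose dg monom_q_props by simp
  have "ord0 ?f + degree ?f = d"
    by (rule ord0_plus_degree_aff[OF h weyl_yz[OF inv(2,3)] f])
  then have "d = q * (ord0 R + q * degree R)" by (simp add: ofx dfx algebra_simps)
  moreover have "ord0 R \<le> degree R" using R0 by (rule order_degree)
  ultimately show ?thesis using ofx dfx by blast
qed

text \<open>On X = 0 the diagonal element with entries 1/a, 1, a acts as T -> a*T.\<close>

lemma torus_exponents:
  assumes "inv_zx F" "inv_xz F" and c: "coeff (aff F) k \<noteq> 0"
  shows "(q - 1) dvd k"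
proof (rule exponent_dvd)
  fix a assume a: "a \<in> Fq" "a \<noteq> 0"
  have "aff F = aff (subst3 (const3 (inverse a) * varX) varY (const3 a * varZ) F)"
    using torus_xz[OF assms(1,2) a] by simp
  also have "\<dots> = pcompose (aff F) ([:a:] * indet)"
    by (simp add: aff_subst3 pcompose_aff)
  also have "[:a:] * indet = [:0, a:]" by (simp add: indet_def)
  finally have "aff F = pcompose (aff F) [:0, a:]" .
  then have "coeff (aff F) k = a ^ k * coeff (aff F) k"
    by (metis coeff_pcompose_linear)
  then show "a ^ k = 1" using c by simp
qed

text \<open>The torus condition is applied to the lowest exponent q*e and the highest exponent
  q^2*u; as q - 1 is prime to q, it divides e and u. The order is part of the conclusion because the
  irreducibility of D2 and the uniqueness of D1 both turn on v.\<close>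

theorem invariant_degree:
  assumes h: "homogeneous3 d F" and d: "d > 0" and f: "aff F \<noteq> 0"
    and inv: "inv_zx F" "inv_zy F" "inv_yz F" "inv_xz F"
  shows "\<exists>v w. v \<le> w \<and> w \<ge> 1 \<and> d = q * (q - 1) * (v + q * w) \<and> ord0 (aff F) = q * (q - 1) * v"
proof -
  obtain e u where eu: "e \<le> u" "d = q * (e + q * u)" "ord0 (aff F) = q * e" "degree (aff F) = q * (q * u)"
    using shape[OF h f inv(1-3)] by blast
  have "algebraic_semidom_class.coprime (q - 1) q" using q2 by (intro coprime_diff_one_left_nat) simp
  have "(q - 1) dvd q * e"
    using torus_exponents[OF inv(1,4)] ord0_props(1)[OF f] eu(3) by metis
  then have "(q - 1) dvd e" using \<open>algebraic_semidom_class.coprime (q - 1) q\<close> by (simp add: coprime_dvd_mult_right_iff)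
  then obtain v where v: "e = (q - 1) * v" by auto
  have "(q - 1) dvd q * (q * u)"
    using torus_exponents[OF inv(1,4), of "q * (q * u)"] f eu(4) by (metis leading_coeff_0_iff)
  then have "(q - 1) dvd u" using \<open>algebraic_semidom_class.coprime (q - 1) q\<close> by (simp add: coprime_dvd_mult_right_iff)
  then obtain w where w: "u = (q - 1) * w" by auto
  have "v \<le> w" using eu(1) q2 by (simp add: v w)
  moreover have "w \<ge> 1" using d eu(2) \<open>v \<le> w\<close> v w by (cases w) auto
  moreover have "d = q * (q - 1) * (v + q * w)" by (simp add: eu(2) v w algebra_simps)
  ultimately show ?thesis using eu(3) v by (intro exI[of _ v] exI[of _ w]) simp
qed

subsection \<open>Dickson invariants\<close>

text \<open>The additive polynomials killing the F_q-span of y, of y, z and of y, z, x respectively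
  are T^q - y^(q-1) T, T^(q^2) - c21 T^q + c20 T and T^(q^3) - C1 T^(q^2) + C2 T^q - C0 T.\<close>

definition f1 :: "'r::comm_ring_1 \<Rightarrow> 'r \<Rightarrow> 'r" where
  "f1 y t = t ^ q - t * y ^ (q - 1)"
definition f2 :: "'r::comm_ring_1 \<Rightarrow> 'r \<Rightarrow> 'r \<Rightarrow> 'r" where
  "f2 y z t = f1 y t ^ q - f1 y t * f1 y z ^ (q - 1)"
definition c21 :: "'r::comm_ring_1 \<Rightarrow> 'r \<Rightarrow> 'r" where
  "c21 y z = y ^ (q * (q - 1)) + f1 y z ^ (q - 1)"
definition c20 :: "'r::comm_ring_1 \<Rightarrow> 'r \<Rightarrow> 'r" where
  "c20 y z = y ^ (q - 1) * f1 y z ^ (q - 1)"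
definition C1 :: "'r::comm_ring_1 \<Rightarrow> 'r \<Rightarrow> 'r \<Rightarrow> 'r" where
  "C1 x y z = f2 y z x ^ (q - 1) + c21 y z ^ q"
definition C2 :: "'r::comm_ring_1 \<Rightarrow> 'r \<Rightarrow> 'r \<Rightarrow> 'r" where
  "C2 x y z = c20 y z ^ q + f2 y z x ^ (q - 1) * c21 y z"

text \<open>The determinant with rows (t, t^(q^i), t^(q^j)) for t = x, y, z, expanded along its
  first column. Dickson invariants are quotients of such Moore determinants.\<close>

definition moore :: "nat \<Rightarrow> nat \<Rightarrow> 'r::comm_ring_1 \<Rightarrow> 'r \<Rightarrow> 'r \<Rightarrow> 'r" where
  "moore i j x y z = x * (y ^ (q ^ i) * z ^ (q ^ j) - y ^ (q ^ j) * z ^ (q ^ i))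
     - y * (x ^ (q ^ i) * z ^ (q ^ j) - x ^ (q ^ j) * z ^ (q ^ i))
     + z * (x ^ (q ^ i) * y ^ (q ^ j) - x ^ (q ^ j) * y ^ (q ^ i))"

lemma f2_expand:
  fixes t :: "'r::comm_ring_1"
  assumes "CHAR('r) = p"
  shows "f2 y z t = t ^ (q ^ 2) - c21 y z * t ^ q + c20 y z * t"
proof -
  have "f1 y t ^ q = t ^ (q ^ 2) - t ^ q * y ^ (q * (q - 1))"
    unfolding f1_def frobenius1(2)[OF assms] power_mult_distrib
    by (simp only: power2_eq_square power_mult[symmetric] mult.commute)
  then show ?thesis
    unfolding f2_def c21_def c20_def by (simp add: f1_def[of y t] algebra_simps)
qed

text \<open>As a polynomial in t, \<open>f2 y z t\<close> vanishes at y and z; its q-th power minus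
  \<open>f2 y z x ^ (q - 1)\<close> times itself vanishes at x as well. Expanding this gives
  \<open>C1\<close> and \<open>C2\<close> as coefficients.\<close>

lemma dickson_relation:
  fixes x :: "'r::comm_ring_1"
  assumes c: "CHAR('r) = p" and t: "t = x \<or> t = y \<or> t = z"
  shows "t ^ (q ^ 3) = C1 x y z * t ^ (q ^ 2) - C2 x y z * t ^ q + c20 y z * f2 y z x ^ (q - 1) * t"
proof -
  have "f1 y y = 0" unfolding f1_def using power_q[of y] by (simp add: mult.commute)
  have s: "s ^ q = s * s ^ (q - 1)" for s :: 'r using power_q[of s] by (simp add: mult.commute)
  have z0: "(0 :: 'r) ^ q = 0" using q2 by (simp add: zero_power)
  have "f2 y z t ^ q = f2 y z t * f2 y z x ^ (q - 1)"
    using t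
  proof (elim disjE)
    assume "t = x" then show ?thesis by (simp only: s)
  next
    assume "t = y" then show ?thesis by (simp add: f2_def \<open>f1 y y = 0\<close> z0)
  next
    assume "t = z"
    have "f2 y z z = 0" unfolding f2_def s[of "f1 y z"] by simp
    then show ?thesis by (simp add: \<open>t = z\<close> z0)
  qed
  moreover have "f2 y z t ^ q = t ^ (q ^ 3) - c21 y z ^ q * t ^ (q ^ 2) + c20 y z ^ q * t ^ q"
    unfolding f2_expand[OF c] frobenius1[OF c] power_mult_distrib
    by (simp only: power2_eq_square power3_eq_cube power_mult[symmetric] mult.assoc)
  ultimately show ?thesis
    unfolding C1_def C2_def by (subst (asm) f2_expand[OF c, of y z t]) (simp add: algebra_simps)
qed

text \<open>Cramer's rule: when the column of t^(q^3) is rewritten by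
  \<open>dickson_relation\<close>, only the summand t^(q^2) does not repeat another column.\<close>

lemma C1_moore:
  fixes x :: "'r::comm_ring_1"
  assumes c: "CHAR('r) = p"
  shows "C1 x y z * moore 1 2 x y z = moore 1 3 x y z"
  unfolding moore_def power_one_right
    dickson_relation[OF c, of x x y z, simplified] dickson_relation[OF c, of y x y z, simplified]
    dickson_relation[OF c, of z x y z, simplified]
  by (simp add: algebra_simps)

lemma C2_moore:
  fixes x :: "'r::comm_ring_1"
  assumes c: "CHAR('r) = p"
  shows "C2 x y z * moore 1 2 x y z = moore 2 3 x y z"
  unfolding moore_def power_one_right
    dickson_relation[OF c, of x x y z, simplified] dickson_relation[OF c, of y x y z, simplified]
    dickson_relation[OF c, of z x y z, simplified]
  by (simp add: algebra_simps)

lemma dickson_hom: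
  assumes "rhom h"
  shows "h (f1 y t) = f1 (h y) (h t)" "h (f2 y z t) = f2 (h y) (h z) (h t)"
    "h (c21 y z) = c21 (h y) (h z)" "h (c20 y z) = c20 (h y) (h z)"
    "h (C1 x y z) = C1 (h x) (h y) (h z)" "h (C2 x y z) = C2 (h x) (h y) (h z)"
    "h (moore i j x y z) = moore i j (h x) (h y) (h z)"
  by (simp_all add: f1_def f2_def c21_def c20_def C1_def C2_def moore_def rhomD[OF assms])

section \<open>Invariance of the Dickson forms under GL(3,q)\<close>

definition lin :: "'k \<Rightarrow> 'k \<Rightarrow> 'k \<Rightarrow> 'k poly3" where
  "lin a b c = const3 a * varX + const3 b * varY + const3 c * varZ"

lemma Fq_power: "a \<in> Fq \<Longrightarrow> a ^ (q ^ m) = a"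
  by (induct m) (simp_all add: Fq_def power_mult)

lemma lin_power:
  assumes "a \<in> Fq" "b \<in> Fq" "c \<in> Fq"
  shows "lin a b c ^ (q ^ m) =
    const3 a * varX ^ (q ^ m) + const3 b * varY ^ (q ^ m) + const3 c * varZ ^ (q ^ m)"
  unfolding lin_def frobenius[OF chars(3)] power_mult_distrib
  using assms by (simp add: Fq_power flip: const3_simps(6))

lemma det3_mult:
  fixes a b c d e f g h k :: "'r::comm_ring_1"
  defines "A \<equiv> \<lambda>x y z. a * x + b * y + c * z" and "B \<equiv> \<lambda>x y z. d * x + e * y + f * z"
    and "C \<equiv> \<lambda>x y z. g * x + h * y + k * z"
  shows "A x y z * (B x1 y1 z1 * C x2 y2 z2 - B x2 y2 z2 * C x1 y1 z1)
    - B x y z * (A x1 y1 z1 * C x2 y2 z2 - A x2 y2 z2 * C x1 y1 z1)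
    + C x y z * (A x1 y1 z1 * B x2 y2 z2 - A x2 y2 z2 * B x1 y1 z1)
    = (a * (e * k - f * h) - b * (d * k - f * g) + c * (d * h - e * g)) *
      (x * (y1 * z2 - y2 * z1) - y * (x1 * z2 - x2 * z1) + z * (x1 * y2 - x2 * y1))"
  unfolding A_def B_def C_def by (simp add: algebra_simps)

text \<open>Frobenius fixes the coefficients, so a linear change over F_q multiplies the Moore
  matrix by the coefficient matrix; \<open>det3_mult\<close> is the product rule for
  determinants.\<close>

lemma moore_lin:
  assumes "a \<in> Fq" "b \<in> Fq" "c \<in> Fq" "d \<in> Fq" "e \<in> Fq" "f \<in> Fq" "g \<in> Fq" "h \<in> Fq" "k \<in> Fq"
  shows "moore i j (lin a b c) (lin d e f) (lin g h k) =
    const3 (a * (e * k - f * h) - b * (d * k - f * g) + c * (d * h - e * g)) * moore i j varX varY varZ"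
  unfolding moore_def lin_power[OF assms(1-3)] lin_power[OF assms(4-6)] lin_power[OF assms(7-9)]
  unfolding lin_def const3_simps by (rule det3_mult)

lemma moore_12_nonzero: "moore 1 2 varX varY varZ \<noteq> (0 :: 'k poly3)"
proof
  assume 0: "moore 1 2 varX varY varZ = (0 :: 'k poly3)"
  \<comment> \<open>At (1, T, T^2) the determinant is the Vandermonde determinant of T, T^q,
    T^(q^2), and its top exponent q + 2*q^2 occurs only once.\<close>
  let ?h = "ev (\<lambda>c. [:c:]) 1 indet (indet ^ 2) :: 'k poly3 \<Rightarrow> 'k poly"
  have "?h (moore 1 2 varX varY varZ) = moore 1 2 1 indet (indet ^ 2)"
    unfolding dickson_hom(7)[OF rhom_ev[OF rhom_const]] by (simp add: rhom_const)
  then have "moore 1 2 1 indet (indet ^ 2) = (0 :: 'k poly)"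
    unfolding 0 rhomD(1)[OF rhom_ev[OF rhom_const]] by (rule sym)
  then have "coeff (moore 1 2 1 indet (indet ^ 2) :: 'k poly) (q + 2 * q ^ 2) = 0" by simp
  moreover have ineq: "q ^ 2 > q" "q > 0" "q > 1" using q2 by (auto simp: power2_eq_square)
  moreover have "moore 1 2 1 indet (indet ^ 2) =
    monom (1 :: 'k) (q + 2 * q ^ 2) - monom 1 (q ^ 2 + 2 * q) - (monom 1 (1 + 2 * q ^ 2) - monom 1 (1 + 2 * q))
    + (monom 1 (2 + q ^ 2) - monom 1 (2 + q))"
  proof -
    have i: "indet = monom (1 :: 'k) (Suc 0)" using indet_power[where k = 1, where 'a = 'k] by simp
    show ?thesis
      unfolding moore_def unfolding power_mult[symmetric] unfolding indet_power unfolding i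
      by (simp add: mult_monom algebra_simps)
  qed
  ultimately show False by (simp add: coeff_diff)
qed

definition D1 :: "'k poly3" where "D1 = C1 varX varY varZ"
definition D2 :: "'k poly3" where "D2 = C2 varX varY varZ"

text \<open>The determinant of the substitution cancels in the quotient of two Moore determinants.
  Hence any nonzero determinant is allowed, in particular that of a transposition of the
  variables.\<close>

lemma D_subst:
  assumes "a \<in> Fq" "b \<in> Fq" "c \<in> Fq" "d \<in> Fq" "e \<in> Fq" "f \<in> Fq" "g \<in> Fq" "h \<in> Fq" "k \<in> Fq"
    and det: "a * (e * k - f * h) - b * (d * k - f * g) + c * (d * h - e * g) \<noteq> 0"
  shows "subst3 (lin a b c) (lin d e f) (lin g h k) D1 = D1"
    "subst3 (lin a b c) (lin d e f) (lin g h k) D2 = D2"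
proof -
  let ?s = "subst3 (lin a b c) (lin d e f) (lin g h k)"
  let ?m = "moore 1 2 varX varY varZ :: 'k poly3"
  let ?d = "a * (e * k - f * h) - b * (d * k - f * g) + c * (d * h - e * g)"
  note m = moore_lin[OF assms(1-9)]
  have "?s D1 * (const3 ?d * ?m) = C1 (lin a b c) (lin d e f) (lin g h k) * moore 1 2 (lin a b c) (lin d e f) (lin g h k)"
    unfolding D1_def dickson_hom[OF rhom_subst3] m by (simp add: rhom_const3)
  also have "\<dots> = moore 1 3 (lin a b c) (lin d e f) (lin g h k)" by (rule C1_moore[OF chars(3)])
  also have "\<dots> = const3 ?d * moore 1 3 varX varY varZ" by (rule m)
  also have "\<dots> = const3 ?d * (D1 * ?m)" by (simp only: D1_def C1_moore[OF chars(3)])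
  finally have "?s D1 * (const3 ?d * ?m) = D1 * (const3 ?d * ?m)" by (simp only: mult.left_commute)
  then show "?s D1 = D1" using det moore_12_nonzero by (simp del: One_nat_def)
  have "?s D2 * (const3 ?d * ?m) = C2 (lin a b c) (lin d e f) (lin g h k) * moore 1 2 (lin a b c) (lin d e f) (lin g h k)"
    unfolding D2_def dickson_hom[OF rhom_subst3] m by (simp add: rhom_const3)
  also have "\<dots> = moore 2 3 (lin a b c) (lin d e f) (lin g h k)" by (rule C2_moore[OF chars(3)])
  also have "\<dots> = const3 ?d * moore 2 3 varX varY varZ" by (rule m)
  also have "\<dots> = const3 ?d * (D2 * ?m)" by (simp only: D2_def C2_moore[OF chars(3)])
  finally have "?s D2 * (const3 ?d * ?m) = D2 * (const3 ?d * ?m)" by (simp only: mult.left_commute)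
  then show "?s D2 = D2" using det moore_12_nonzero by (simp del: One_nat_def)
qed

lemma transform3_D:
  assumes "A \<in> SL3 q"
  shows "transform3 A D1 = D1" "transform3 A D2 = D2"
proof -
  have F: "vec_nth (vec_nth A i) j \<in> Fq" for i j using assms by (simp add: SL3_def Fq_def)
  have l: "linrow A i = lin (vec_nth (vec_nth A i) 1) (vec_nth (vec_nth A i) 2) (vec_nth (vec_nth A i) 3)" for i by (simp add: linrow_def lin_def)
  have "Determinants.det A = 1" using assms by (simp add: SL3_def)
  then have "vec_nth (vec_nth A 1) 1 * (vec_nth (vec_nth A 2) 2 * vec_nth (vec_nth A 3) 3 - vec_nth (vec_nth A 2) 3 * vec_nth (vec_nth A 3) 2) - vec_nth (vec_nth A 1) 2 * (vec_nth (vec_nth A 2) 1 * vec_nth (vec_nth A 3) 3 - vec_nth (vec_nth A 2) 3 * vec_nth (vec_nth A 3) 1)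
    + vec_nth (vec_nth A 1) 3 * (vec_nth (vec_nth A 2) 1 * vec_nth (vec_nth A 3) 2 - vec_nth (vec_nth A 2) 2 * vec_nth (vec_nth A 3) 1) \<noteq> 0"
    by (simp add: Determinants.det_3 algebra_simps)
  then show "transform3 A D1 = D1" "transform3 A D2 = D2"
    unfolding transform3_def eval3_eq_ev l by (intro D_subst F; simp)+
qed

lemma lin_var: "varX = lin 1 0 0" "varY = lin 0 1 0" "varZ = lin 0 0 1"
  by (simp_all add: lin_def const3_simps)

lemma D_swap:
  "subst3 varY varX varZ D1 = D1" "subst3 varX varZ varY D1 = D1" "subst3 varZ varY varX D1 = D1"
  "subst3 varY varX varZ D2 = D2" "subst3 varX varZ varY D2 = D2" "subst3 varZ varY varX D2 = D2"
  unfolding lin_var by (rule D_subst; simp)+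

lemma D_elementary:
  assumes "a \<in> Fq"
  shows "subst3 varX varY (varZ + const3 a * varX) D1 = D1" "subst3 varX varY (varZ + const3 a * varX) D2 = D2"
    "subst3 varX varY (varZ + const3 a * varY) D2 = D2"
proof -
  have l: "varZ + const3 a * varX = lin a 0 1" "varZ + const3 a * varY = lin 0 a 1"
    by (simp_all add: lin_def const3_simps add.commute)
  show "subst3 varX varY (varZ + const3 a * varX) D1 = D1" "subst3 varX varY (varZ + const3 a * varX) D2 = D2"
    "subst3 varX varY (varZ + const3 a * varY) D2 = D2"
    unfolding l unfolding lin_var using assms by (auto intro!: D_subst)
qed

lemma homogeneous3_cong: "homogeneous3 d F \<Longrightarrow> d = e \<Longrightarrow> homogeneous3 e F"
  by simp

lemma homogeneous3_D: "homogeneous3 (q ^ 3 - q ^ 2) D1" "homogeneous3 (q ^ 3 - q) D2"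
proof -
  obtain r where r: "q = Suc r" using q2 by (cases q) auto
  have f1: "homogeneous3 q (f1 (varY :: 'k poly3) t)" if "homogeneous3 1 t" for t
    unfolding f1_def
    by (rule homogeneous3_diff; rule homogeneous3_cong)
      (rule homogeneous3_power that homogeneous3_mult homogeneous3_var | (simp add: r; fail))+
  have f2: "homogeneous3 (q ^ 2) (f2 varY varZ (varX :: 'k poly3))"
    unfolding f2_def
    by (rule homogeneous3_diff; rule homogeneous3_cong)
      (rule homogeneous3_power homogeneous3_mult f1 homogeneous3_var | (simp add: r power2_eq_square; fail))+
  have c21: "homogeneous3 (q * (q - 1)) (c21 varY (varZ :: 'k poly3))"
    unfolding c21_def
    by (rule homogeneous3_add; rule homogeneous3_cong)
      (rule homogeneous3_power homogeneous3_mult f1 homogeneous3_var | (simp add: r power2_eq_square; fail))+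
  have c20: "homogeneous3 ((q + 1) * (q - 1)) (c20 varY (varZ :: 'k poly3))"
    unfolding c20_def
    by (rule homogeneous3_cong)
      (rule homogeneous3_power homogeneous3_mult f1 homogeneous3_var | (simp add: r algebra_simps; fail))+
  have "homogeneous3 (q * (q - 1) * q) D1"
    unfolding D1_def C1_def
    by (rule homogeneous3_add; rule homogeneous3_cong)
      (rule homogeneous3_power homogeneous3_mult f2 c21 | (simp add: power2_eq_square; fail))+
  then show "homogeneous3 (q ^ 3 - q ^ 2) D1"
    by (rule homogeneous3_cong) (simp add: r power2_eq_square power3_eq_cube algebra_simps)
  have "homogeneous3 ((q + 1) * (q - 1) * q) D2"
    unfolding D2_def C2_def
    by (rule homogeneous3_add; rule homogeneous3_cong)
      (rule homogeneous3_power homogeneous3_mult f2 c21 c20 | (simp add: power2_eq_square algebra_simps; fail))+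
  then show "homogeneous3 (q ^ 3 - q) D2"
    by (rule homogeneous3_cong) (simp add: r power2_eq_square power3_eq_cube algebra_simps)
qed

lemma f2_0 [simp]: "f2 y z 0 = 0"
  using q2 by (simp add: f2_def f1_def zero_power)

text \<open>On X = 0 every multiple of \<open>f2\<close> drops out and pure q-th powers
  remain.\<close>

lemma aff_D: "aff D1 = c21 1 indet ^ q" "aff D2 = c20 1 indet ^ q"
  using q2 unfolding D1_def D2_def dickson_hom[OF rhom_aff]
  by (simp_all add: C1_def C2_def zero_power)

text \<open>Over K this identifies the roots of \<open>c21 1 t\<close>: they are the elements of
  F_(q^2) outside F_q.\<close>

lemma c21_mult_f1:
  fixes t :: "'r::comm_ring_1"
  assumes "CHAR('r) = p"
  shows "c21 1 t * f1 1 t = t ^ (q ^ 2) - t"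
proof -
  have "c21 1 t * f1 1 t = f1 1 t + f1 1 t ^ q"
    by (simp add: c21_def distrib_right power_q[of "f1 1 t"])
  also have "\<dots> = t ^ (q ^ 2) - t"
    unfolding f1_def frobenius1(2)[OF assms] power_one mult_1_right
    by (simp add: power2_eq_square power_mult)
  finally show ?thesis .
qed

lemma DGZ_eq: "DGZ q = D1"
proof -
  \<comment> \<open>Row operations with the row of Z reduce the Moore determinant to a 2x2
    determinant in \<open>hX\<close> and \<open>hY\<close>, up to sign and a factor Z. Both cancel
    in the DGZ quotient.\<close>
  have h: "varZ * (hX q i * hY q 1 - hY q i * hX q 1) = - moore 1 i varX varY (varZ :: 'k poly3)" if "i \<ge> 1" for i
  proof -
    have z: "s * varZ ^ (q ^ m - 1) * varZ = s * varZ ^ (q ^ m)" for m and s :: "'k poly3"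
    proof -
      have "q ^ m > 0" using q2 by simp
      then show ?thesis unfolding mult.assoc by (simp only: power_minus_mult)
    qed
    have "varZ * (varZ * (hX q i * hY q 1 - hY q i * hX q 1)) = (hX q i * varZ) * (hY q 1 * varZ) - (hY q i * varZ) * (hX q 1 * varZ)"
      by (simp add: algebra_simps)
    also have "\<dots> = varZ * (- moore 1 i varX varY (varZ :: 'k poly3))"
      unfolding hX_def hY_def left_diff_distrib z moore_def by (simp add: algebra_simps)
    finally show ?thesis by (simp add: varZ_def)
  qed
  let ?n = "hX q 3 * hY q 1 - hY q 3 * hX q 1 :: 'k poly3" and ?d = "hX q 2 * hY q 1 - hY q 2 * hX q 1 :: 'k poly3"
  have "varZ * ?n = - moore 1 3 varX varY varZ" by (rule h) simp
  also have "\<dots> = - (D1 * moore 1 2 varX varY varZ)"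
    unfolding D1_def by (simp only: C1_moore[OF chars(3)])
  also have "\<dots> = D1 * (varZ * ?d)" using h[of 2] by (simp del: One_nat_def)
  finally have "varZ * ?n = varZ * (D1 * ?d)" by (simp only: mult.left_commute)
  then have n: "?n = D1 * ?d" by (simp add: varZ_def)
  have "?d \<noteq> 0" using h[of 2] moore_12_nonzero by auto
  then show ?thesis unfolding DGZ_def n by simp
qed

end

subsection \<open>Irreducibility of D1\<close>

lemma unit_poly3:
  fixes F :: "'k::field poly3"
  assumes "F dvd 1" shows "\<exists>c. c \<noteq> 0 \<and> F = const3 c"
proof -
  obtain G where G: "F = [:G:]" "G dvd 1" using assms is_unit_poly_iff by blast
  obtain H where H: "G = [:H:]" "H dvd 1" using G(2) is_unit_poly_iff by blast
  obtain c where "H = [:c:]" "c dvd 1" using H(2) is_unit_poly_iff by blast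
  then show ?thesis by (intro exI[of _ c]) (auto simp: G H const3_def)
qed

lemma const3_unit: "c \<noteq> 0 \<Longrightarrow> const3 (c :: 'k::field) dvd 1"
  by (rule dvdI[of _ _ "const3 (inverse c)"]) (simp flip: const3_simps)

lemma homogeneous3_nonunit:
  fixes F :: "'k::field poly3"
  assumes "homogeneous3 d F" "F \<noteq> 0" shows "F dvd 1 \<longleftrightarrow> d = 0"
proof
  assume "F dvd 1"
  then obtain c where "F = const3 c" using unit_poly3 by blast
  then show "d = 0" using homogeneous3_unique[OF assms(1) _ assms(2)] homogeneous3_const by blast
next
  assume "d = 0"
  then obtain c where "F = const3 c" using homogeneous3_0D assms(1) by blast
  then show "F dvd 1" using assms(2) by (auto intro!: const3_unit)
qed

lemma irreducible_factor:
  fixes F :: "'a::ufd"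
  assumes "F \<noteq> 0" "\<not> F dvd 1"
  obtains f where "irreducible f" "f dvd F"
proof -
  obtain M where "mset_factors M F" using mset_factors_exist assms by blast
  then obtain f where "f \<in># M" "irreducible f" "f dvd F"
    by (metis mset_factors_def multiset_nonemptyE mset_factors_imp_dvd)
  then show thesis using that by blast
qed

lemma irreducible_image:
  assumes h: "rhom \<phi>" "rhom \<psi>" and inv: "\<And>x. \<psi> (\<phi> x) = x" "\<And>x. \<phi> (\<psi> x) = x" and F: "irreducible F"
  shows "irreducible (\<phi> F)"
proof (rule irreducibleI)
  note [simp] = rhomD[OF h(1)] rhomD[OF h(2)] inv
  show "\<phi> F \<noteq> 0" using F inv(1)[of F] by (auto simp del: inv)
  have u: "x dvd 1 \<longleftrightarrow> \<psi> x dvd 1" for x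
  proof
    assume "x dvd 1" then obtain y where "1 = x * y" by (auto elim: dvdE)
    then have "1 = \<psi> x * \<psi> y" by (metis rhomD(2,4) h(2))
    then show "\<psi> x dvd 1" ..
  next
    assume "\<psi> x dvd 1" then obtain y where "1 = \<psi> x * y" by (auto elim: dvdE)
    then have "1 = x * \<phi> y" by (metis rhomD(2,4) h(1) inv(2))
    then show "x dvd 1" ..
  qed
  show "\<not> \<phi> F dvd 1" using F by (simp add: u irreducible_not_unit)
  fix a b assume "\<phi> F = a * b"
  then have "F = \<psi> a * \<psi> b" by (metis inv(1) rhomD(4)[OF h(2)])
  then show "a dvd 1 \<or> b dvd 1" using F irreducibleD u by blast
qed

lemma dvd_image: "rhom h \<Longrightarrow> x dvd y \<Longrightarrow> h x dvd h y"
  by (metis dvd_def rhomD(4))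

lemma irreducible_swap:
  fixes F :: "'k::field poly3"
  assumes "irreducible F"
  shows "irreducible (subst3 varY varX varZ F)" "irreducible (subst3 varX varZ varY F)"
    "irreducible (subst3 varZ varY varX F)"
proof -
  note s = ev_subst3 rhom_const3 ev_id
  show "irreducible (subst3 varY varX varZ F)"
    by (rule irreducible_image[OF rhom_subst3, where \<psi> = "subst3 varY varX varZ"])
      (simp_all add: s rhom_subst3 assms)
  show "irreducible (subst3 varX varZ varY F)"
    by (rule irreducible_image[OF rhom_subst3, where \<psi> = "subst3 varX varZ varY"])
      (simp_all add: s rhom_subst3 assms)
  show "irreducible (subst3 varZ varY varX F)"
    by (rule irreducible_image[OF rhom_subst3, where \<psi> = "subst3 varZ varY varX"])
      (simp_all add: s rhom_subst3 assms)
qed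

lemma irreducible_shift:
  fixes F :: "'k::field poly3"
  assumes "irreducible F"
  shows "irreducible (subst3 varX varY (varZ + const3 a * varX) F)"
    "irreducible (subst3 varX varY (varZ + const3 a * varY) F)"
proof -
  note s = ev_subst3 rhom_const3 ev_id rhomD[OF rhom_subst3]
  show "irreducible (subst3 varX varY (varZ + const3 a * varX) F)"
    by (rule irreducible_image[OF rhom_subst3, where \<psi> = "subst3 varX varY (varZ - const3 a * varX)"])
      (simp_all add: s rhom_subst3 assms)
  show "irreducible (subst3 varX varY (varZ + const3 a * varY) F)"
    by (rule irreducible_image[OF rhom_subst3, where \<psi> = "subst3 varX varY (varZ - const3 a * varY)"])
      (simp_all add: s rhom_subst3 assms)
qed

text \<open>A shift of Z preserves the leading coefficient in Z, so a semi-invariant is an invariant.\<close>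
lemma shift_semi_invariant:
  fixes F :: "'k::field poly3"
  assumes "F \<noteq> 0" "subst3 varX varY (varZ + [:r:]) F = const3 c * F"
  shows "subst3 varX varY (varZ + [:r:]) F = F"
proof -
  have W: "varZ + [:r:] = [:r, 1:]" by (simp add: varZ_def)
  have "lead_coeff F = lead_coeff (const3 c * F)"
    unfolding assms(2)[symmetric] subst3_Z W by (subst lead_coeff_comp) auto
  also have "\<dots> = [:[:c:]:] * lead_coeff F" by (simp add: const3_def)
  finally have "(1 - [:[:c:]:]) * lead_coeff F = 0" by (simp add: algebra_simps)
  then have "[:[:c:]:] = 1" using assms(1) by simp
  then have "const3 c = 1" by (simp add: const3_def)
  then show ?thesis using assms(2) by simp
qed

text \<open>Irreducible forms dividing one another differ by a scalar, which
  \<open>shift_semi_invariant\<close> removes.\<close>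

lemma shift_irreducible_factor:
  fixes F :: "'k::field poly3"
  assumes F: "irreducible F" and d: "subst3 varX varY (varZ + [:r:]) F dvd F"
    and i: "irreducible (subst3 varX varY (varZ + [:r:]) F)"
  shows "subst3 varX varY (varZ + [:r:]) F = F"
proof -
  let ?T = "subst3 varX varY (varZ + [:r:]) F"
  obtain H where H: "F = ?T * H" using d ..
  then have "H dvd 1" using F i irreducibleD irreducible_not_unit by metis
  then obtain c where c: "c \<noteq> 0" "H = const3 c" using unit_poly3 by blast
  have "const3 (inverse c) * F = ?T * const3 (inverse c * c)"
    unfolding const3_simps(4) by (subst H) (simp add: c algebra_simps)
  also have "\<dots> = ?T" using c by (simp add: const3_simps)
  finally have e: "?T = const3 (inverse c) * F" by simp
  have "F \<noteq> 0" using F by auto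
  from shift_semi_invariant[OF this e] show ?thesis .
qed

context closed_field
begin

text \<open>Permutations of the coordinates conjugate the four families into one another, and the
  two transpositions generate all permutations.\<close>

lemma inv_by_symmetry:
  assumes Q: "Q F"
    and swap: "\<And>F. Q F \<Longrightarrow> Q (subst3 varY varX varZ F)" "\<And>F. Q F \<Longrightarrow> Q (subst3 varX varZ varY F)"
    and zx: "\<And>F. Q F \<Longrightarrow> inv_zx F"
  shows "inv_zx F" "inv_zy F" "inv_yz F" "inv_xz F"
proof -
  note s = ev_subst3 rhom_const3 rhomD[OF rhom_subst3] ev_id
  show "inv_zx F" by (rule zx[OF Q])
  show "inv_zy F"
    unfolding inv_zy_def
  proof
    fix a assume a: "a \<in> Fq"
    have "subst3 varX varY (varZ + const3 a * varX) (subst3 varY varX varZ F) = subst3 varY varX varZ F"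
      using zx[OF swap(1)[OF Q]] a by (simp add: inv_zx_def)
    from arg_cong[OF this, of "subst3 varY varX varZ"]
    show "subst3 varX varY (varZ + const3 a * varY) F = F" by (simp add: s)
  qed
  show "inv_yz F"
    unfolding inv_yz_def
  proof
    fix a assume a: "a \<in> Fq"
    have "subst3 varX varY (varZ + const3 a * varX) (subst3 varY varX varZ (subst3 varX varZ varY F))
        = subst3 varY varX varZ (subst3 varX varZ varY F)"
      using zx[OF swap(1)[OF swap(2)[OF Q]]] a by (simp add: inv_zx_def)
    from arg_cong[OF this, of "subst3 varZ varX varY"]
    show "subst3 varX (varY + const3 a * varZ) varZ F = F" by (simp add: s)
  qed
  show "inv_xz F"
    unfolding inv_xz_def
  proof
    fix a assume a: "a \<in> Fq"
    have "subst3 varX varY (varZ + const3 a * varX) (subst3 varY varX varZ (subst3 varX varZ varY (subst3 varY varX varZ F)))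
        = subst3 varY varX varZ (subst3 varX varZ varY (subst3 varY varX varZ F))"
      using zx[OF swap(1)[OF swap(2)[OF swap(1)[OF Q]]]] a by (simp add: inv_zx_def)
    from arg_cong[OF this, of "subst3 varZ varY varX"]
    show "subst3 (varX + const3 a * varZ) varY varZ F = F" by (simp add: s)
  qed
qed

section \<open>Branches at a point of D1 on the axis X = 0\<close>

lemma const3_var_pCons: "const3 a * varX = [:[:[:0, a:]:]:]" "const3 a * varY = [:[:0, [:a:]:]:]"
  by (simp_all add: const3_def varX_def varY_def)

text \<open>At the point (0, 1, l) with l in F_(q^2) but not in F_q put X = m s^q, Z = l + s^(q-1). With
  s as outer and m as inner variable, the image of this substitution is contained in the span of
  the monomials (m s^q)^k (s^(q-1))^i. Below s^(q(q-1)) every power of s belongs to at most one of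
  them, whereas the lowest term of D1 is a binomial in m at s^(q(q-1)).\<close>

definition wt :: "'k poly poly \<Rightarrow> bool" where
  "wt f \<longleftrightarrow> (\<forall>w k. coeff (coeff f w) k \<noteq> 0 \<longrightarrow> (\<exists>i. w = q * k + (q - 1) * i))"

lemma wt_add: "wt f \<Longrightarrow> wt g \<Longrightarrow> wt (f + g)"
  unfolding wt_def by (metis coeff_add add_0)

lemma wt_mult:
  assumes "wt f" "wt g" shows "wt (f * g)"
  unfolding wt_def
proof (intro allI impI)
  fix w k assume "coeff (coeff (f * g) w) k \<noteq> 0"
  then have "(\<Sum>a\<le>w. \<Sum>b\<le>k. coeff (coeff f a) b * coeff (coeff g (w - a)) (k - b)) \<noteq> 0"
    by (simp add: coeff_mult coeff_sum)
  then obtain a where a: "a \<le> w" "(\<Sum>b\<le>k. coeff (coeff f a) b * coeff (coeff g (w - a)) (k - b)) \<noteq> 0"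
    by (metis (no_types, lifting) sum.not_neutral_contains_not_neutral atMost_iff)
  then obtain b where b: "b \<le> k" "coeff (coeff f a) b * coeff (coeff g (w - a)) (k - b) \<noteq> 0"
    by (metis (no_types, lifting) sum.not_neutral_contains_not_neutral atMost_iff)
  then obtain i j where "a = q * b + (q - 1) * i" "w - a = q * (k - b) + (q - 1) * j"
    using assms unfolding wt_def by (metis mult_not_zero)
  then have "w = q * (b + (k - b)) + (q - 1) * (i + j)"
    using a(1) by (simp only: distrib_left)
  then show "\<exists>i. w = q * k + (q - 1) * i" using b(1) by auto
qed

text \<open>Modulo q - 1 the exponent q*k + (q - 1)*i is k, and an exponent below q*(q - 1) forces k
  < q - 1. So the power of s determines the power of m.\<close>

lemma wt_lowest:
  assumes "wt f" "ord0 f < q * (q - 1)" "f \<noteq> 0"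
  obtains c k where "coeff f (ord0 f) = monom c k" "c \<noteq> 0"
proof -
  let ?w = "ord0 f"
  have u: "k = ?w mod (q - 1)" if nz: "coeff (coeff f ?w) k \<noteq> 0" for k
  proof -
    obtain i where i: "?w = q * k + (q - 1) * i" using nz assms(1) unfolding wt_def by blast
    then have "q * k < q * (q - 1)" using assms(2) by linarith
    then have "k < q - 1" by simp
    obtain r where r: "q = Suc r" using q2 by (cases q) auto
    have "?w = k + r * (k + i)" using i by (simp add: r algebra_simps)
    then show ?thesis using \<open>k < q - 1\<close> by (simp add: r)
  qed
  have "coeff f ?w = monom (coeff (coeff f ?w) (?w mod (q - 1))) (?w mod (q - 1))"
    using u by (intro poly_eqI) (auto simp: coeff_monom)
  moreover have "coeff f ?w \<noteq> 0" by (rule ord0_props(1)[OF assms(3)])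
  ultimately show thesis using that by (metis monom_eq_0)
qed

definition branch :: "'k \<Rightarrow> 'k poly3 \<Rightarrow> 'k poly poly" where
  "branch l = ev (\<lambda>c. [:[:c:]:]) (monom indet q) 1 ([:[:l:]:] + monom 1 (q - 1))"

lemma rhom_branch: "rhom (branch l)"
  unfolding branch_def by (intro rhom_ev rhom_comp[OF rhom_const rhom_const])

lemma branch_var:
  "branch l (const3 c) = [:[:c:]:]" "branch l varX = monom indet q" "branch l varY = 1"
  "branch l varZ = [:[:l:]:] + monom 1 (q - 1)"
  by (simp_all add: branch_def rhom_comp[OF rhom_const rhom_const])

lemma wt_const: "wt [:[:c:]:]"
  unfolding wt_def by (auto simp: coeff_pCons split: nat.splits)

lemma wt_branch: "wt (branch l F)"
proof (induct F rule: poly3_induct)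
  case (const c)
  show ?case using wt_const by (simp add: branch_var)
next
  case (add F G)
  then show ?case by (simp add: rhomD[OF rhom_branch] wt_add)
next
  case (X F)
  have "wt (monom indet q)" unfolding wt_def
    by (auto simp: coeff_monom indet_def coeff_pCons split: nat.splits if_splits)
  with X show ?case
    unfolding rhomD[OF rhom_branch] branch_var by (intro wt_mult)
next
  case (Y F)
  then show ?case
    by (simp add: rhomD[OF rhom_branch] branch_var)
next
  case (Z F)
  have "wt (monom 1 (q - 1))" unfolding wt_def
    by (auto simp: coeff_monom intro!: exI[of _ 1] split: if_splits)
  with Z show ?case
    unfolding rhomD[OF rhom_branch] branch_var by (intro wt_mult wt_add wt_const)
qed

lemma branch_at_0: "poly (branch l F) 0 = [:poly (aff F) l:]"
proof -
  have r: "rhom (\<lambda>f :: 'k poly poly. poly f 0)" "rhom (\<lambda>f :: 'k poly. [:poly f l:])"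
    by (simp_all add: rhom_def)
  have "poly (branch l F) 0 = ev (\<lambda>c. [:c:]) 0 1 [:l:] F"
    unfolding branch_def using q2
    by (subst ev_hom[OF r(1) rhom_comp[OF rhom_const rhom_const]]) (simp add: poly_monom zero_power)
  moreover have "[:poly (aff F) l:] = ev (\<lambda>c. [:c:]) 0 1 [:l:] F"
    unfolding aff_def
    by (subst ev_hom[OF r(2) rhom_const]) (simp add: indet_def one_pCons[symmetric])
  ultimately show ?thesis by simp
qed

text \<open>The weights q of X and q - 1 of Z - l give the summands \<open>f2 ^ (q - 1)\<close> and
  \<open>c21 ^ q\<close> of \<open>C1\<close> the same order q*(q - 1) in s. The first contributes a
  multiple of m^(q - 1), the second a nonzero constant.\<close>

lemma branch_D1:
  assumes l: "c21 1 l = 0"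
  obtains H a b where "branch l D1 = monom 1 (q * (q - 1)) * H" "poly H 0 = monom a (q - 1) + [:b:]"
    "a \<noteq> 0" "b \<noteq> 0"
proof -
  define z :: "'k poly poly" where "z = [:[:l:]:] + monom 1 (q - 1)"
  define A where "A = f1 1 z"
  \<comment> \<open>The value of T^q - T at l. It is nonzero, since otherwise \<open>c21 1 l\<close>
    would be 1.\<close>
  define \<delta> where "\<delta> = l ^ q - l"
  have q0: "q > 0" "q - 1 > 0" using q2 by auto
  have l2: "l ^ (q ^ 2) = l" using c21_mult_f1[OF char, of l] l by simp
  have \<delta>: "\<delta> \<noteq> 0"
  proof
    assume "\<delta> = 0"
    then have "f1 1 l = 0" by (simp add: f1_def \<delta>_def)
    then have "c21 1 l = 1" using q0 by (simp add: c21_def zero_power)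
    then show False using l by simp
  qed
  have zq: "z ^ (q ^ m) = [:[:l ^ (q ^ m):]:] + monom 1 ((q - 1) * q ^ m)" for m
    unfolding z_def frobenius(1)[OF chars(2)] by (simp add: poly_const_pow monom_power)
  have A0: "poly A 0 = [:\<delta>:]"
    using q0 zq[of 1] by (simp add: A_def f1_def \<delta>_def z_def poly_monom zero_power)
  \<comment> \<open>Multiplication by A, which does not vanish at s = 0, makes \<open>c21\<close>
    computable: as l^(q^2) = l, the product has only two terms.\<close>
  have "c21 1 z * A = z ^ (q ^ 2) - z" unfolding A_def by (rule c21_mult_f1[OF chars(2)])
  also have "\<dots> = monom 1 ((q - 1) * q ^ 2) - monom 1 (q - 1)" unfolding zq l2 by (simp add: z_def)
  also have "\<dots> = monom 1 (q - 1) * (monom 1 ((q - 1) * (q ^ 2 - 1)) - 1)"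
  proof -
    have "q ^ 2 = 1 + (q ^ 2 - 1)" using q0 by simp
    then have "(q - 1) * q ^ 2 = (q - 1) + (q - 1) * (q ^ 2 - 1)" by (metis distrib_left mult_1_right)
    then show ?thesis by (simp add: right_diff_distrib mult_monom)
  qed
  finally have cA: "c21 1 z * A = monom 1 (q - 1) * (monom 1 ((q - 1) * (q ^ 2 - 1)) - 1)" .
  have d: "monom 1 (q - 1) dvd c21 1 z * A" unfolding cA by (rule dvd_triv_left)
  have "poly A 0 \<noteq> 0" using \<delta> by (simp add: A0)
  from ord0_ge_cancel[OF d this] have "monom 1 (q - 1) dvd c21 1 z" .
  then obtain B where B: "c21 1 z = monom 1 (q - 1) * B" ..
  have "monom 1 (q - 1) * (B * A) = monom 1 (q - 1) * (monom 1 ((q - 1) * (q ^ 2 - 1)) - 1)"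
    using cA by (simp only: B mult.assoc)
  then have BA: "B * A = monom 1 ((q - 1) * (q ^ 2 - 1)) - 1" by simp
  have "1 < q ^ 2" using q2 by (intro one_less_power) auto
  then have "poly B 0 * [:\<delta>:] = - 1"
    using arg_cong[OF BA, of "\<lambda>f. poly f 0"] A0 q0 by (simp add: poly_monom zero_power)
  then have "smult \<delta> (poly B 0) = - 1" by (simp add: mult.commute)
  then have "smult (inverse \<delta>) (smult \<delta> (poly B 0)) = [:- inverse \<delta>:]" by simp
  then have B0: "poly B 0 = [:- inverse \<delta>:]" using \<delta> by simp
  define x :: "'k poly poly" where "x = monom indet q"
  define E where "E = monom (indet ^ (q ^ 2)) (q ^ 3 - q) - c21 1 z * monom (indet ^ q) (q ^ 2 - q) + A ^ (q - 1) * [:indet:]"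
  have xk: "x ^ k = monom (indet ^ k) (q * k)" for k by (simp add: x_def monom_power)
  have qs: "q ^ 3 = q + (q ^ 3 - q)" "q * q = q + (q ^ 2 - q)" "q * q ^ 2 = q ^ 3" "q ^ 2 > q" "q ^ 3 > q"
  proof -
    show 1: "q ^ 2 > q" "q ^ 3 > q"
      using power_strict_increasing[of 1 2 q] power_strict_increasing[of 1 3 q] q2 by simp_all
    show "q * q ^ 2 = q ^ 3" by (simp add: power2_eq_square power3_eq_cube)
    show "q ^ 3 = q + (q ^ 3 - q)" "q * q = q + (q ^ 2 - q)" using 1 by (simp_all add: power2_eq_square)
  qed
  have "f2 1 z x = x ^ (q ^ 2) - c21 1 z * x ^ q + A ^ (q - 1) * x"
    unfolding f2_expand[OF chars(2)] c20_def A_def by simp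
  also have "\<dots> = monom 1 q * E"
    unfolding xk E_def distrib_left right_diff_distrib mult.left_commute[of "monom 1 q"] mult_monom
    unfolding qs(3) by (simp add: mult_monom x_def qs(1,2)[symmetric] monom_0[symmetric])
  finally have f2: "f2 1 z x = monom 1 q * E" .
  have E0: "poly E 0 = smult (\<delta> ^ (q - 1)) indet"
    using qs(4,5) by (simp add: E_def poly_monom A0 poly_const_pow zero_power)
  have br: "branch l D1 = C1 x 1 z"
    unfolding D1_def dickson_hom[OF rhom_branch]
    by (simp add: branch_def rhom_comp[OF rhom_const rhom_const] x_def z_def)
  define H where "H = E ^ (q - 1) + B ^ q"
  have "branch l D1 = monom 1 (q * (q - 1)) * H"
    unfolding br C1_def f2 B H_def power_mult_distrib monom_power
    by (simp add: distrib_left mult.commute)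
  moreover have "poly H 0 = monom ((\<delta> ^ (q - 1)) ^ (q - 1)) (q - 1) + [:(- inverse \<delta>) ^ q:]"
    by (simp add: H_def E0 B0 smult_power indet_power smult_monom poly_const_pow)
  ultimately show thesis using that \<delta> by (metis inverse_nonzero_iff_nonzero neg_equal_0_iff_equal power_not_zero)
qed

text \<open>If both factors vanished at the point, both orders in s would be positive with sum q*(q
  - 1), so \<open>wt_lowest\<close> would apply to each. A product of two monomials in m is not the
  binomial of \<open>branch_D1\<close>.\<close>

lemma D1_local:
  assumes FG: "D1 = F * G" and l: "c21 1 l = 0" and FP: "poly (aff F) l = 0" and GP: "poly (aff G) l = 0"
  shows False
proof -
  obtain H a b where H: "branch l D1 = monom 1 (q * (q - 1)) * H" "poly H 0 = monom a (q - 1) + [:b:]"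
    and ab: "a \<noteq> 0" "b \<noteq> 0" using branch_D1[OF l] .
  let ?f = "branch l F" and ?g = "branch l G"
  have q1: "q - 1 > 0" using q2 by simp
  have c0: "coeff (poly H 0) 0 \<noteq> 0" "coeff (poly H 0) (q - 1) \<noteq> 0"
    using ab q1 by (auto simp: H(2) coeff_pCons split: nat.splits)
  then have H0: "poly H 0 \<noteq> 0" "H \<noteq> 0" by auto
  have fg: "?f * ?g = monom 1 (q * (q - 1)) * H" unfolding H(1)[symmetric] FG rhomD[OF rhom_branch] ..
  then have nz: "?f \<noteq> 0" "?g \<noteq> 0" using H0(2) by (auto simp: monom_eq_0_iff)
  obtain f m where f: "?f = monom 1 m * f" "m = ord0 ?f" using ord0_decomp[OF nz(1)] by metis
  obtain g m' where g: "?g = monom 1 m' * g" "m' = ord0 ?g" using ord0_decomp[OF nz(2)] by metis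
  have "ord0 (monom 1 (q * (q - 1)) * H) = q * (q - 1)"
    using H0 by (subst order_mult) (auto simp: monom_eq_0_iff order_0I)
  moreover have "ord0 (?f * ?g) = ord0 ?f + ord0 ?g" by (rule order_mult) (use nz in simp)
  ultimately have o: "ord0 ?f + ord0 ?g = q * (q - 1)" unfolding fg by simp
  have "monom 1 (q * (q - 1)) * (f * g) = monom 1 (q * (q - 1)) * H"
  proof -
    have "monom 1 (q * (q - 1)) = monom 1 m * monom (1 :: 'k poly) m'"
      by (simp only: mult_monom o f(2) g(2) mult_1_right)
    then have "monom 1 (q * (q - 1)) * (f * g) = ?f * ?g"
      unfolding f(1) g(1) by (simp only: mult.assoc mult.left_commute)
    then show ?thesis unfolding fg .
  qed
  then have fgH: "f * g = H" by (simp add: monom_eq_0_iff)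
  have "ord0 ?f \<noteq> 0" "ord0 ?g \<noteq> 0"
    using branch_at_0[of l F] branch_at_0[of l G] FP GP nz by (simp_all add: order_root)
  then have lt: "ord0 ?f < q * (q - 1)" "ord0 ?g < q * (q - 1)" using o by linarith+
  obtain c j where c: "coeff ?f (ord0 ?f) = monom c j" using wt_lowest[OF wt_branch lt(1) nz(1)] .
  obtain e k where e: "coeff ?g (ord0 ?g) = monom e k" using wt_lowest[OF wt_branch lt(2) nz(2)] .
  have "poly f 0 = monom c j" "poly g 0 = monom e k"
  proof -
    have low: "coeff (monom 1 i * h) i = poly h 0" for i and h :: "'k poly poly"
      by (simp add: coeff_monom_mult poly_0_coeff_0)
    show "poly f 0 = monom c j" "poly g 0 = monom e k"
      using c e low[of m f] low[of m' g] f g by metis+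
  qed
  then have "poly H 0 = monom (c * e) (j + k)"
    unfolding fgH[symmetric] by (simp add: mult_monom)
  then have "j + k = 0" "j + k = q - 1" using c0 by (auto simp: coeff_monom split: if_splits)
  then show False using q1 by simp
qed

lemma D1_nonzero: "D1 \<noteq> 0" "aff D1 \<noteq> 0" "degree (aff D1) = q ^ 3 - q ^ 2"
proof -
  have d: "degree (f1 1 indet :: 'k poly) = q"
    unfolding f1_def indet_power using q2
    by (subst degree_diff_left) (auto simp: indet_def degree_monom_eq)
  have f0: "f1 1 indet \<noteq> (0 :: 'k poly)" using d q2 by auto
  have dd: "degree (monom 1 (q ^ 2) - indet :: 'k poly) = q ^ 2"
    using one_less_power[of q 2] q2 by (subst degree_diff_left) (auto simp: indet_def degree_monom_eq)
  have c: "c21 1 indet * f1 1 indet = (monom 1 (q ^ 2) - indet :: 'k poly)"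
    unfolding c21_mult_f1[OF chars(1)] indet_power ..
  have c0: "c21 1 indet \<noteq> (0 :: 'k poly)"
  proof
    assume "c21 1 indet = (0 :: 'k poly)"
    then have "degree (monom 1 (q ^ 2) - indet :: 'k poly) = 0" unfolding c[symmetric] by simp
    then show False unfolding dd using q2 by simp
  qed
  have "degree (c21 1 indet :: 'k poly) + q = q ^ 2"
    using degree_mult_eq[OF c0 f0] unfolding c dd d by simp
  then have "q * (degree (c21 1 indet :: 'k poly) + q) = q * q ^ 2" by simp
  then have "degree (c21 1 indet ^ q :: 'k poly) = q ^ 3 - q ^ 2"
    unfolding degree_power_eq[OF c0] by (simp add: power2_eq_square power3_eq_cube distrib_left ac_simps)
  then show "aff D1 \<noteq> 0" "degree (aff D1) = q ^ 3 - q ^ 2" unfolding aff_D using c0 by simp_all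
  then show "D1 \<noteq> 0" by auto
qed

text \<open>If the product loses no degree on X = 0, neither does a factor. For D1 this means that
  no component contains (0, 0, 1), so each has an affine point on the axis.\<close>

lemma aff_factor_degree:
  fixes F G :: "'k poly3"
  assumes FG: "homogeneous3 N (F * G)" "degree (aff (F * G)) = N" "aff (F * G) \<noteq> 0" and F: "homogeneous3 d F"
  shows "degree (aff F) = d"
proof -
  have nz: "F * G \<noteq> 0" using FG(3) by (metis rhomD(1)[OF rhom_aff])
  have nz': "aff F \<noteq> 0" "aff G \<noteq> 0" using FG(3) by auto
  obtain d' e where de: "homogeneous3 d' F" "homogeneous3 e G" "d' + e = N"
    using homogeneous3_factor[OF FG(1) nz] by blast
  have "d' = d" using homogeneous3_unique[OF de(1) F] nz by auto
  have "degree (aff F) + degree (aff G) = N"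
    using degree_mult_eq[OF nz'] FG(2) by simp
  then show ?thesis using degree_aff_le[OF de(1)] degree_aff_le[OF de(2)] de(3) \<open>d' = d\<close> by linarith
qed

lemma D1_factor_inv_zx:
  assumes F: "irreducible F" "F dvd D1"
  shows "inv_zx F"
  unfolding inv_zx_def
proof
  fix a assume a: "a \<in> Fq"
  let ?T = "subst3 varX varY (varZ + const3 a * varX)"
  obtain G where G: "D1 = F * G" using F(2) ..
  have F0: "F \<noteq> 0" using F(1) by auto
  obtain d where d: "homogeneous3 d F"
    using homogeneous3_factor homogeneous3_D(1) D1_nonzero(1) G by metis
  have "d > 0" using homogeneous3_nonunit[OF d F0] F(1) irreducible_not_unit by blast
  have "degree (aff F) = d"
    using aff_factor_degree[where F = F and G = G, folded G, OF homogeneous3_D(1) D1_nonzero(3,2) d] .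
  then obtain l where l: "poly (aff F) l = 0" using alg_closed[of "aff F"] \<open>d > 0\<close> by auto
  have r: "rhom (\<lambda>f :: 'k poly. poly f l)" by (simp add: rhom_def)
  have "poly (aff D1) l = 0" using l by (simp add: G)
  then have cl: "c21 1 l = 0"
    by (simp add: aff_D dickson_hom(3)[OF r]) (simp add: indet_def)
  have T: "irreducible (?T F)" by (rule irreducible_shift(1)[OF F(1)])
  have "?T F dvd F * G"
    using dvd_image[OF rhom_subst3 F(2)] D_elementary(1)[OF a] G by metis
  then have "?T F dvd F \<or> ?T F dvd G"
    using T by (simp add: prime_elem_dvd_mult_iff)
  moreover have "\<not> ?T F dvd G"
  proof
    assume "?T F dvd G"
    then have "aff (?T F) dvd aff G" by (rule dvd_image[OF rhom_aff])
    \<comment> \<open>The elation fixes its axis pointwise, so G would pass through the chosen point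
      of F.\<close>
    moreover have "aff (?T F) = aff F" by (simp add: aff_subst3) (simp add: aff_def)
    ultimately have "poly (aff G) l = 0" using l by (auto elim!: dvdE)
    then show False using D1_local[OF G cl l] by blast
  qed
  ultimately have "?T F dvd F" by blast
  with T show "?T F = F"
    unfolding const3_var_pCons by (intro shift_irreducible_factor[OF F(1)])
qed

theorem irreducible_D1: "irreducible D1"
proof -
  have deg: "q ^ 3 - q ^ 2 = q * (q - 1) * q" by (simp add: power2_eq_square power3_eq_cube algebra_simps)
  have "q ^ 3 - q ^ 2 > 0" unfolding deg using q2 by simp
  then have "\<not> D1 dvd 1" using homogeneous3_nonunit[OF homogeneous3_D(1) D1_nonzero(1)] by simp
  then obtain F where F: "irreducible F" "F dvd D1" using irreducible_factor[OF D1_nonzero(1)] by blast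
  have inv: "inv_zx F" "inv_zy F" "inv_yz F" "inv_xz F"
  proof -
    let ?Q = "\<lambda>F. irreducible F \<and> F dvd D1"
    have "?Q (subst3 varY varX varZ F)" "?Q (subst3 varX varZ varY F)" if "?Q F" for F
      using that irreducible_swap dvd_image[OF rhom_subst3] D_swap(1,2) by metis+
    then show "inv_zx F" "inv_zy F" "inv_yz F" "inv_xz F"
      using inv_by_symmetry[of ?Q F] F D1_factor_inv_zx by auto
  qed
  obtain G where G: "D1 = F * G" using F(2) ..
  obtain d e where d: "homogeneous3 d F" "homogeneous3 e G" "d + e = q ^ 3 - q ^ 2"
    using homogeneous3_factor[of _ F G] homogeneous3_D(1) D1_nonzero(1) G by metis
  have nz: "F \<noteq> 0" "G \<noteq> 0" "aff F \<noteq> 0" using D1_nonzero G by auto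
  have "d > 0" using homogeneous3_nonunit[OF d(1) nz(1)] F(1) irreducible_not_unit by blast
  then obtain v w where "w \<ge> 1" "d = q * (q - 1) * (v + q * w)"
    using invariant_degree[OF d(1) _ nz(3) inv] by blast
  \<comment> \<open>As w >= 1, the component already has the full degree of D1.\<close>
  moreover from this have "q \<le> v + q * w" by (cases w) auto
  ultimately have "q ^ 3 - q ^ 2 \<le> d" unfolding deg by simp
  then have "e = 0" using d(3) by simp
  then have "G dvd 1" using homogeneous3_nonunit[OF d(2) nz(2)] by simp
  then show ?thesis using F(1) unfolding G by (simp add: irreducible_mult_unit_right)
qed

end

subsection \<open>Irreducibility of D2\<close>

lemma coeff3_swaps:
  "coeff3 (subst3 varY varX varZ F) i j k = coeff3 F j i k"
  "coeff3 (subst3 varZ varY varX F) i j k = coeff3 F k j i"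
  by (induct F arbitrary: i j k rule: poly3_induct)
    (auto simp: coeff3_simps rhomD[OF rhom_subst3] rhom_const3)

text \<open>The shift fixes the point (1, 0, 0), and the coefficient of X^d decides whether a form
  of degree d passes through it.\<close>

lemma coeff3_shift: "coeff3 (subst3 varX varY (varZ + const3 a * varY) F) i 0 0 = coeff3 F i 0 0"
proof (induct F arbitrary: i rule: poly3_induct)
  case (Z F)
  have "(varZ + const3 a * varY) * H = varZ * H + varY * (const3 a * H)" for H :: "'a poly3"
    by (simp add: algebra_simps)
  then show ?case by (simp add: rhomD[OF rhom_subst3] rhom_const3 coeff3_simps)
qed (auto simp: coeff3_simps rhomD[OF rhom_subst3] rhom_const3)

text \<open>F(1, T, Z) as a polynomial in Z over K[T].\<close>
definition chart :: "'k::comm_ring_1 poly3 \<Rightarrow> 'k poly poly" where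
  "chart = ev (\<lambda>c. [:[:c:]:]) 1 [:indet:] indet"

lemma rhom_chart: "rhom chart"
  unfolding chart_def by (intro rhom_ev rhom_comp[OF rhom_const rhom_const])

lemma chart_var [simp]:
  "chart (const3 c) = [:[:c:]:]" "chart varX = 1" "chart varY = [:indet:]" "chart varZ = indet"
  by (simp_all add: chart_def rhom_comp[OF rhom_const rhom_const])

lemma chart_subst3_Z: "chart (subst3 varX varY W F) = pcompose (chart F) (chart W)"
proof -
  have "pcompose (chart F) (chart W) = ev (\<lambda>c. [:[:c:]:]) 1 [:indet:] (chart W) F"
    unfolding chart_def
    by (subst ev_hom[OF rhom_pcompose rhom_comp[OF rhom_const rhom_const]]) (simp add: pcompose_1)
  moreover have "chart (subst3 varX varY W F) = ev (\<lambda>c. [:[:c:]:]) 1 [:indet:] (chart W) F"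
    unfolding chart_def
    by (simp add: ev_subst3 rhom_comp[OF rhom_const rhom_const])
  ultimately show ?thesis by simp
qed

lemma coeff_chart: "coeff (coeff (chart F) k) j = poly (coeff (coeff F k) j) 1"
proof (induct F arbitrary: j k rule: poly3_induct)
  case (const c)
  show ?case unfolding chart_var by (simp add: const3_def coeff_pCons split: nat.splits)
next
  case (add F G)
  then show ?case by (simp add: rhomD[OF rhom_chart])
next
  case (X F)
  have "chart (varX * F) = chart F" by (simp add: rhomD[OF rhom_chart])
  with X show ?case by (simp only:) (simp add: varX_def)
next
  case (Y F)
  have "chart (varY * F) = smult indet (chart F)" by (simp add: rhomD[OF rhom_chart])
  with Y show ?case by (simp only:) (simp add: varY_def indet_def coeff_pCons split: nat.splits)
next
  case (Z F)
  have "chart (varZ * F) = indet * chart F" by (simp add: rhomD[OF rhom_chart])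
  with Z show ?case by (simp only:) (simp add: varZ_def indet_def coeff_pCons split: nat.splits)
qed

text \<open>The leading coefficient in Z is the tangent cone at (0, 0, 1), of degree d minus the
  degree in Z; putting X = 1 can only lower its degree.\<close>

lemma chart_homogeneous:
  assumes h: "homogeneous3 d F"
  shows "degree (coeff (chart F) k) \<le> d - k" "degree (chart F) \<le> d"
    "coeff3 F 0 0 d = 0 \<Longrightarrow> coeff (chart F) d = 0"
proof -
  have z: "coeff (coeff (chart F) k) j = 0" if "j + k > d" for j k
  proof -
    have "coeff (coeff F k) j = 0"
      using h that by (intro poly_eqI) (force simp: homogeneous3_def coeff3_def)
    then show ?thesis by (simp add: coeff_chart)
  qed
  show "degree (coeff (chart F) k) \<le> d - k" by (rule degree_le) (auto intro!: z)
  show "degree (chart F) \<le> d" by (rule degree_le) (auto intro!: poly_eqI z)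
  assume 0: "coeff3 F 0 0 d = 0"
  show "coeff (chart F) d = 0"
  proof (rule poly_eqI)
    fix j
    have "coeff (coeff F d) 0 = 0"
    proof (rule poly_eqI)
      fix i show "coeff (coeff (coeff F d) 0) i = coeff 0 i"
        using h 0 by (cases "i = 0") (force simp: homogeneous3_def coeff3_def)+
    qed
    then show "coeff (coeff (chart F) d) j = coeff 0 j"
      using z[where k = d and j = j] by (cases "j = 0") (auto simp: coeff_chart)
  qed
qed

context closed_field
begin

lemma degree_c21: "degree (c21 1 indet :: 'k poly) = q * (q - 1)" "c21 1 indet \<noteq> (0 :: 'k poly)"
proof -
  have e: "degree (c21 1 indet ^ q :: 'k poly) = q ^ 3 - q ^ 2" "c21 1 indet ^ q \<noteq> (0 :: 'k poly)"
    using D1_nonzero(2,3) unfolding aff_D by auto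
  show 0: "c21 1 indet \<noteq> (0 :: 'k poly)" using e(2) q2 by (auto simp: zero_power)
  obtain r where r: "q = Suc r" using q2 by (cases q) auto
  have "q ^ 3 - q ^ 2 = q * (q * (q - 1))" by (simp add: r power2_eq_square power3_eq_cube algebra_simps)
  then show "degree (c21 1 indet :: 'k poly) = q * (q - 1)"
    using e(1) q2 unfolding degree_power_eq[OF 0] by simp
qed

text \<open>A double root would be one of T^(q^2) - T, whose derivative is -1. This makes the
  tangents of D2 at (0, 0, 1) distinct.\<close>

lemma c21_separable: "\<not> [:- t, 1:] ^ 2 dvd (c21 1 indet :: 'k poly)"
proof
  assume "[:- t, 1:] ^ 2 dvd (c21 1 indet :: 'k poly)"
  then have "[:- t, 1:] ^ 2 dvd c21 1 indet * (f1 1 indet :: 'k poly)" by (rule dvd_mult2)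
  then have "[:- t, 1:] ^ 2 dvd (monom 1 (q ^ 2) - indet :: 'k poly)"
    unfolding c21_mult_f1[OF chars(1)] indet_power .
  then obtain g where g: "monom 1 (q ^ 2) - indet = [:- t, 1:] ^ 2 * g" ..
  have "pderiv (monom 1 (q ^ 2) - indet :: 'k poly) = - 1"
    by (simp add: pderiv_diff pderiv_monom indet_def pderiv_pCons of_nat_q)
  moreover have "poly (pderiv ([:- t, 1:] ^ 2 * g)) t = 0"
    by (simp add: pderiv_mult power2_eq_square del: mult_pCons_left mult_pCons_right)
  ultimately show False unfolding g by simp
qed

lemma chart_D2: "degree (chart D2) = q ^ 2 * (q - 1)" "lead_coeff (chart D2) = c21 1 indet"
proof -
  let ?Y = "[:indet:] :: 'k poly poly"
  \<comment> \<open>The cyclic permutation puts Z in the place of x in \<open>C2\<close>, where it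
    enters only through \<open>f2\<close>, monic of degree q^2 in Z.\<close>
  have cyc: "subst3 varZ varX varY D2 = D2"
    unfolding lin_var by (rule D_subst) simp_all
  have "D2 = C2 varZ varX varY"
  proof -
    have "subst3 varZ varX varY D2 = C2 varZ varX varY"
      unfolding D2_def dickson_hom[OF rhom_subst3] by (simp add: rhom_const3)
    then show ?thesis unfolding cyc .
  qed
  then have "chart D2 = C2 indet 1 ?Y"
    by (simp add: dickson_hom[OF rhom_chart])
  also have "\<dots> = c20 1 ?Y ^ q + f2 1 ?Y indet ^ (q - 1) * c21 1 ?Y" by (simp add: C2_def)
  finally have "chart D2 = c20 1 ?Y ^ q + f2 1 ?Y indet ^ (q - 1) * c21 1 ?Y" .
  moreover have Y: "c20 1 ?Y = [:c20 1 indet:]" "c21 1 ?Y = [:c21 1 indet:]"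
    using dickson_hom(3,4)[OF rhom_const, of 1 indet, symmetric] unfolding one_pCons[symmetric] by auto
  ultimately have e: "chart D2 = f2 1 ?Y indet ^ (q - 1) * [:c21 1 indet:] + [:c20 1 indet ^ q:]"
    by (simp add: poly_const_pow)
  let ?f = "f2 1 ?Y indet"
  have 1: "q < q ^ 2" "1 < q ^ 2" using q2 by (auto simp: power2_eq_square intro: one_less_mult)
  have "?f = monom 1 (q ^ 2) - (monom (c21 1 indet) q - monom (c20 1 indet) 1)"
    unfolding f2_expand[OF chars(2)] Y indet_power
    by (simp add: smult_monom indet_power[of 1, simplified])
  moreover have "degree (monom (c21 1 indet) q - monom (c20 1 indet) 1 :: 'k poly poly) < q ^ 2"
    using degree_diff_le[of "monom (c21 1 indet :: 'k poly) q" q "monom (c20 1 indet) 1"] 1 q2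
    by (meson degree_monom_le le_less_trans order_trans le_trans one_le_numeral less_imp_le)
  ultimately have f: "degree ?f = q ^ 2" "lead_coeff ?f = 1"
    using 1 by (auto simp: degree_diff_left degree_monom_eq coeff_eq_0)
  then have f0: "?f \<noteq> 0" by auto
  have m: "degree (?f ^ (q - 1) * [:c21 1 indet:]) = q ^ 2 * (q - 1)"
    "lead_coeff (?f ^ (q - 1) * [:c21 1 indet:]) = c21 1 indet"
  proof -
    have fp: "degree (?f ^ (q - 1)) = q ^ 2 * (q - 1)" "lead_coeff (?f ^ (q - 1)) = 1"
      unfolding lead_coeff_power f(2) using f(1) f0 by (simp_all add: degree_power_eq)
    show "degree (?f ^ (q - 1) * [:c21 1 indet:]) = q ^ 2 * (q - 1)"
      using f0 degree_c21(2) fp(1) by (subst degree_mult_eq) simp_all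
    show "lead_coeff (?f ^ (q - 1) * [:c21 1 indet:]) = c21 1 indet"
      unfolding lead_coeff_mult fp(2) by simp
  qed
  have pos: "q ^ 2 * (q - 1) > 0" using q2 by simp
  show d: "degree (chart D2) = q ^ 2 * (q - 1)"
    unfolding e using m pos by (subst degree_add_eq_left) simp_all
  show "lead_coeff (chart D2) = c21 1 indet"
    unfolding d unfolding e coeff_add m(2)[unfolded m(1)] using pos by (simp add: coeff_eq_0)
qed

lemma homogeneous_degree_D2: "q ^ 3 - q = q ^ 2 * (q - 1) + q * (q - 1)" "q ^ 3 - q = q * (q - 1) * (1 + q)" "q ^ 3 - q > 0"
proof -
  obtain r where r: "q = Suc r" using q2 by (cases q) auto
  show "q ^ 3 - q = q ^ 2 * (q - 1) + q * (q - 1)" and *: "q ^ 3 - q = q * (q - 1) * (1 + q)"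
    by (simp_all add: r power2_eq_square power3_eq_cube algebra_simps)
  show "q ^ 3 - q > 0" unfolding * using q2 by simp
qed

text \<open>The restriction is (T^q - T)^(q*(q - 1)): apart from (0, 0, 1), D2 meets the axis in
  rational points only, each of high multiplicity.\<close>

lemma aff_D2_props: "aff D2 \<noteq> 0" "D2 \<noteq> 0" "poly (aff D2) t = 0 \<Longrightarrow> t \<in> Fq" "ord0 (aff D2) = q * (q - 1)"
proof -
  have c: "c20 1 indet = f1 1 indet ^ (q - 1)" by (simp add: c20_def)
  have f: "f1 1 indet = monom 1 q - (indet :: 'k poly)" by (simp add: f1_def indet_power)
  have e: "f1 1 indet = indet * (monom 1 (q - 1) - 1 :: 'k poly)"
    unfolding f using power_q[of "indet :: 'k poly"] by (simp add: indet_power algebra_simps)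
  have u: "poly (monom 1 (q - 1) - 1 :: 'k poly) 0 = - 1" using q2 by (simp add: poly_monom zero_power)
  then have u0: "monom 1 (q - 1) - 1 \<noteq> (0 :: 'k poly)" by auto
  have i0: "indet \<noteq> (0 :: 'k poly)" by (simp add: indet_def)
  have "ord0 (indet :: 'k poly) = 1"
    using order_0_monom[of "1 :: 'k" 1] by (simp flip: indet_power)
  then have o: "ord0 (f1 1 indet :: 'k poly) = 1"
    unfolding e using u u0 i0 by (subst order_mult) (auto simp: order_0I)
  have f0: "f1 1 indet \<noteq> (0 :: 'k poly)" unfolding e using u0 i0 by simp
  have a: "aff D2 = f1 1 indet ^ (q * (q - 1))"
    unfolding aff_D c by (simp add: power_mult[symmetric] mult.commute)
  show "aff D2 \<noteq> 0" unfolding a using f0 by simp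
  then show "D2 \<noteq> 0" by auto
  have op: "ord0 (g ^ k) = k * ord0 g" if "g \<noteq> 0" for g :: "'k poly" and k
    using that by (induct k) (simp_all add: order_mult)
  show "ord0 (aff D2) = q * (q - 1)" unfolding a op[OF f0] o by simp
  show "t \<in> Fq" if "poly (aff D2) t = 0"
    using that unfolding a f by (simp add: Fq_def poly_monom indet_def)
qed

text \<open>The condition says that (0, 0, 1) lies on F. The leading coefficient in Z is the product of
  the tangents there; it is fixed by the elations with centre (0, 0, 1), and for D2 it is
  squarefree.\<close>
lemma D2_centre:
  assumes F: "irreducible F" "F dvd D2" and d: "homogeneous3 d F" and P: "coeff3 F 0 0 d = 0"
  shows "inv_zx F" "inv_zy F"
proof -
  obtain G where G: "D2 = F * G" using F(2) ..
  have F0: "F \<noteq> 0" using F(1) by auto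
  obtain d' e where de: "homogeneous3 d' F" "homogeneous3 e G" "d' + e = q ^ 3 - q"
    using homogeneous3_factor[of _ F G] homogeneous3_D(2) aff_D2_props(2) G by metis
  have "d' = d" by (rule homogeneous3_unique[OF de(1) d F0])
  have fg: "chart D2 = chart F * chart G" unfolding G rhomD[OF rhom_chart] ..
  have "chart D2 \<noteq> 0" using chart_D2(1) q2 by (metis degree_0 less_irrefl mult_pos_pos zero_less_power
        less_le_trans pos2 zero_less_diff one_less_numeral_iff semiring_norm(76))
  then have nz: "chart F \<noteq> 0" "chart G \<noteq> 0" using fg by auto
  define lf lg where "lf = lead_coeff (chart F)" and "lg = lead_coeff (chart G)"
  have lfg: "lf * lg = c21 1 indet" unfolding lf_def lg_def chart_D2(2)[symmetric] fg lead_coeff_mult ..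
  have l0: "lf \<noteq> 0" "lg \<noteq> 0" using lfg degree_c21(2) by auto
  \<comment> \<open>The degrees in Z and those of the leading coefficients both add up to the values
    for D2, so the upper bounds below are attained. Thus \<open>lf\<close> has degree d minus the
    degree of F in Z, which is positive because (0, 0, 1) lies on F.\<close>
  have "degree (chart F) + degree (chart G) = q ^ 2 * (q - 1)"
    unfolding chart_D2(1)[symmetric] fg by (rule degree_mult_eq[OF nz, symmetric])
  moreover have "degree lf + degree lg = q * (q - 1)"
    unfolding degree_c21(1)[symmetric] lfg[symmetric] by (rule degree_mult_eq[OF l0, symmetric])
  moreover have "degree lf \<le> d - degree (chart F)" "degree lg \<le> e - degree (chart G)"
    unfolding lf_def lg_def using chart_homogeneous(1) d de(2) by blast+
  moreover have dF: "degree (chart F) \<le> d" "degree (chart G) \<le> e"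
    using chart_homogeneous(2) d de(2) by blast+
  ultimately have "degree lf = d - degree (chart F)"
    using de(3) homogeneous_degree_D2(1) \<open>d' = d\<close> by linarith
  moreover have "degree (chart F) \<noteq> d"
    using chart_homogeneous(3)[OF d P] nz(1) by (metis leading_coeff_0_iff)
  ultimately have "degree lf > 0" using dF(1) by linarith
  then obtain t where "poly lf t = 0" using alg_closed[of lf] by auto
  then have t: "[:- t, 1:] dvd lf" by (simp add: poly_eq_0_iff_dvd)
  have main: "subst3 varX varY (varZ + [:r:]) F = F"
    if i: "irreducible (subst3 varX varY (varZ + [:r:]) F)" and s: "subst3 varX varY (varZ + [:r:]) D2 = D2" for r
  proof -
    let ?T = "subst3 varX varY (varZ + [:r:])"
    have "?T F dvd F * G"
      using dvd_image[OF rhom_subst3 F(2)] s G by metis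
    then have "?T F dvd F \<or> ?T F dvd G"
      using i by (simp add: prime_elem_dvd_mult_iff)
    moreover have "\<not> ?T F dvd G"
    proof
      \<comment> \<open>A shift of Z keeps the leading coefficient, so \<open>lf\<close> would
        divide \<open>lg\<close> and t would be a double root of \<open>c21\<close>.\<close>
      assume "?T F dvd G"
      then obtain H where H: "chart G = chart (?T F) * H" using dvd_image[OF rhom_chart] by (blast elim: dvdE)
      have cW: "\<exists>s. chart (varZ + [:r:]) = [:s, 1:]"
      proof -
        have "degree (chart [:r:]) \<le> 0"
          by (rule degree_le) (auto intro!: poly_eqI simp: coeff_chart coeff_pCons split: nat.splits)
        then obtain s where "chart [:r:] = [:s:]" by (metis degree_eq_zeroE le_zero_eq)
        then show ?thesis by (intro exI[of _ s]) (simp add: rhomD[OF rhom_chart] indet_def)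
      qed
      then obtain s where s: "chart (varZ + [:r:]) = [:s, 1:]" by blast
      have "lead_coeff (chart (?T F)) = lf"
        unfolding lf_def chart_subst3_Z s by (subst lead_coeff_comp) auto
      then have "lf dvd lg" unfolding lg_def H lead_coeff_mult by simp
      then have "[:- t, 1:] * [:- t, 1:] dvd lf * lg" using t by (intro mult_dvd_mono) (auto intro: dvd_trans)
      then show False using c21_separable[of t] unfolding lfg power2_eq_square by blast
    qed
    ultimately have "?T F dvd F" by blast
    with i show "?T F = F" by (intro shift_irreducible_factor[OF F(1)])
  qed
  show "inv_zx F"
    unfolding inv_zx_def
  proof
    fix a assume "a \<in> Fq"
    then show "subst3 varX varY (varZ + const3 a * varX) F = F"
      using main irreducible_shift(1)[OF F(1), of a] D_elementary(2) unfolding const3_var_pCons by blast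
  qed
  show "inv_zy F"
    unfolding inv_zy_def
  proof
    fix a assume "a \<in> Fq"
    then show "subst3 varX varY (varZ + const3 a * varY) F = F"
      using main irreducible_shift(2)[OF F(1), of a] D_elementary(3) unfolding const3_var_pCons by blast
  qed
qed

text \<open>If (0, 0, 1) is not on F, then \<open>aff F\<close> has full degree and thus a root. The
  root lies in F_q, and a shift moves the point to (0, 1, 0).\<close>

lemma D2_root:
  assumes "F dvd D2" "homogeneous3 d F" "d > 0" "coeff3 F 0 0 d \<noteq> 0"
  shows "\<exists>a\<in>Fq. coeff3 (subst3 varX varY (varZ + const3 a * varY) F) 0 d 0 = 0"
proof -
  have c: "coeff (aff F) d \<noteq> 0" using assms(4) by (simp add: coeff_aff_homogeneous[OF assms(2)])
  then have "degree (aff F) \<ge> d" by (rule le_degree)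
  then obtain a where a: "poly (aff F) a = 0" using alg_closed[of "aff F"] assms(3) by auto
  have "aff F dvd aff D2" by (rule dvd_image[OF rhom_aff assms(1)])
  then have "poly (aff D2) a = 0" using a by (auto elim!: dvdE)
  then have aq: "a \<in> Fq" by (rule aff_D2_props(3))
  let ?G = "subst3 varX varY (varZ + const3 a * varY) F"
  have hG: "homogeneous3 d ?G"
    using homogeneous3_mult[OF homogeneous3_const homogeneous3_var(2), of a]
    by (intro homogeneous3_subst3 assms(2) homogeneous3_add homogeneous3_var) simp
  have "aff ?G = pcompose (aff F) (indet + [:a:])" by (simp add: aff_subst3 pcompose_aff)
  then have "coeff (aff ?G) 0 = 0" using a by (simp add: pcompose_coeff_0 indet_def)
  then have "coeff3 ?G 0 d 0 = 0" by (simp add: coeff_aff_homogeneous[OF hG])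
  then show ?thesis using aq by blast
qed

section \<open>Components of D2 and their images under GL(3,q)\<close>

definition D2_comp :: "nat \<Rightarrow> 'k poly3 \<Rightarrow> bool" where
  "D2_comp d F \<longleftrightarrow> irreducible F \<and> F dvd D2 \<and> homogeneous3 d F"

lemma D2_comp_subst:
  assumes "D2_comp d F"
  shows "D2_comp d (subst3 varY varX varZ F)" "D2_comp d (subst3 varX varZ varY F)"
    "D2_comp d (subst3 varZ varY varX F)"
    "a \<in> Fq \<Longrightarrow> D2_comp d (subst3 varX varY (varZ + const3 a * varY) F)"
proof -
  have F: "irreducible F" "F dvd D2" "homogeneous3 d F" using assms by (auto simp: D2_comp_def)
  note dv = dvd_image[OF rhom_subst3 F(2)]
  have h: "homogeneous3 1 (varZ + const3 a * varY)"
    using homogeneous3_mult[OF homogeneous3_const homogeneous3_var(2), of a]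
    by (intro homogeneous3_add homogeneous3_var) simp
  show "D2_comp d (subst3 varY varX varZ F)"
    using irreducible_swap(1)[OF F(1)] dv[of varY varX varZ] homogeneous3_subst3[OF F(3) homogeneous3_var(2,1,3)]
    by (simp add: D2_comp_def D_swap)
  show "D2_comp d (subst3 varX varZ varY F)"
    using irreducible_swap(2)[OF F(1)] dv[of varX varZ varY] homogeneous3_subst3[OF F(3) homogeneous3_var(1,3,2)]
    by (simp add: D2_comp_def D_swap)
  show "D2_comp d (subst3 varZ varY varX F)"
    using irreducible_swap(3)[OF F(1)] dv[of varZ varY varX] homogeneous3_subst3[OF F(3) homogeneous3_var(3,2,1)]
    by (simp add: D2_comp_def D_swap)
  show "D2_comp d (subst3 varX varY (varZ + const3 a * varY) F)" if "a \<in> Fq"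
    using irreducible_shift(2)[OF F(1), of a] dv[of varX varY "varZ + const3 a * varY"] D_elementary(3)[OF that]
      homogeneous3_subst3[OF F(3) homogeneous3_var(1,2) h]
    by (simp add: D2_comp_def)
qed

text \<open>A rational point of the component on X = 0 is moved to (1, 0, 0), off that line; X = 0
  then supplies a second point, and the shift used for it leaves (1, 0, 0) in place.\<close>

lemma D2_comp_two_centres:
  assumes F: "D2_comp d F" and d: "d > 0"
  shows "\<exists>F. D2_comp d F \<and> coeff3 F 0 0 d = 0 \<and> coeff3 F 0 d 0 = 0"
proof -
  have root: "\<exists>a\<in>Fq. coeff3 (subst3 varX varY (varZ + const3 a * varY) F) 0 d 0 = 0"
    if "D2_comp d F" "coeff3 F 0 0 d \<noteq> 0" for F
    using that d by (intro D2_root) (auto simp: D2_comp_def)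
  obtain G where G: "D2_comp d G" "coeff3 G d 0 0 = 0"
  proof (cases "coeff3 F 0 0 d = 0")
    case True
    then show thesis using that[OF D2_comp_subst(3)[OF F]] by (simp add: coeff3_swaps)
  next
    case False
    then obtain a where a: "a \<in> Fq" "coeff3 (subst3 varX varY (varZ + const3 a * varY) F) 0 d 0 = 0"
      using root[OF F] by blast
    then show thesis using that[OF D2_comp_subst(1)[OF D2_comp_subst(4)[OF F a(1)]]] by (simp add: coeff3_swaps)
  qed
  show ?thesis
  proof (cases "coeff3 G 0 0 d = 0")
    case True
    then show ?thesis using D2_comp_subst(1)[OF G(1)] G(2)
      by (intro exI[of _ "subst3 varY varX varZ G"]) (simp add: coeff3_swaps)
  next
    case False
    then obtain a where a: "a \<in> Fq" "coeff3 (subst3 varX varY (varZ + const3 a * varY) G) 0 d 0 = 0"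
      using root[OF G(1)] by blast
    let ?H = "subst3 varX varY (varZ + const3 a * varY) G"
    have "coeff3 ?H d 0 0 = 0" using G(2) by (simp add: coeff3_shift)
    then show ?thesis using D2_comp_subst(3)[OF D2_comp_subst(4)[OF G(1) a(1)]] a(2)
      by (intro exI[of _ "subst3 varZ varY varX ?H"]) (simp add: coeff3_swaps)
  qed
qed

lemma D2_comp_centre:
  assumes "D2_comp d F" "coeff3 F 0 0 d = 0"
  shows "inv_zx F" "inv_zy F"
  using D2_centre[of F d] assms by (auto simp: D2_comp_def)

theorem irreducible_D2: "irreducible D2"
proof -
  have "\<not> D2 dvd 1"
    using homogeneous3_nonunit[OF homogeneous3_D(2) aff_D2_props(2)] homogeneous_degree_D2(3) by simp
  then obtain F0 where F0: "irreducible F0" "F0 dvd D2" using irreducible_factor[OF aff_D2_props(2)] by blast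
  then obtain d where d0: "homogeneous3 d F0"
    using homogeneous3_factor homogeneous3_D(2) aff_D2_props(2) by (metis dvdE)
  have "d > 0"
    using homogeneous3_nonunit[OF d0] F0(1) irreducible_not_unit by (metis gr0I irreducible_def)
  have "D2_comp d F0" using F0 d0 by (simp add: D2_comp_def)
  then obtain F where F: "D2_comp d F" "coeff3 F 0 0 d = 0" "coeff3 F 0 d 0 = 0"
    using D2_comp_two_centres \<open>d > 0\<close> by blast
  have d: "homogeneous3 d F" and irr: "irreducible F" using F(1) by (auto simp: D2_comp_def)
  have "F dvd D2" using F(1) by (simp add: D2_comp_def)
  then obtain G where G: "D2 = F * G" ..
  have f: "aff F \<noteq> 0" using aff_D2_props(1) by (auto simp: G)
  note s = ev_subst3 rhom_const3 rhomD[OF rhom_subst3] ev_id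
  have zx: "inv_zx F" and zy: "inv_zy F" using D2_comp_centre[OF F(1,2)] .
  have yz: "inv_yz F"
    unfolding inv_yz_def
  proof
    fix a assume a: "a \<in> Fq"
    have "inv_zy (subst3 varX varZ varY F)"
      using D2_comp_centre(2)[OF D2_comp_subst(2)[OF F(1)]] F(3) by (simp add: coeff3_swap_YZ)
    then have "subst3 varX varY (varZ + const3 a * varY) (subst3 varX varZ varY F) = subst3 varX varZ varY F"
      using a by (simp add: inv_zy_def)
    from arg_cong[OF this, of "subst3 varX varZ varY"]
    show "subst3 varX (varY + const3 a * varZ) varZ F = F" by (simp add: s)
  qed
  have "coeff (aff F) 0 = 0" using F(3) by (simp add: coeff_aff_homogeneous[OF d])
  then have o0: "ord0 (aff F) \<noteq> 0" using ord0_props(1)[OF f] by metis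
  obtain e u where eu: "e \<le> u" "d = q * (e + q * u)" "ord0 (aff F) = q * e"
    using shape[OF d f zx zy yz] by blast
  have "e \<ge> 1" using o0 eu(3) by (cases e) auto
  \<comment> \<open>Here e >= 1 gives u >= 1. The bound is the multiplicity of T = 0 in
    \<open>aff D2\<close>, and exceeding it will bring the third vertex onto F.\<close>
  have "q * (q - 1) < d"
  proof -
    have "q - 1 < e + q * u" using \<open>e \<ge> 1\<close> eu(1) q2 by (cases u) auto
    then show ?thesis unfolding eu(2) using q2 by simp
  qed
  \<comment> \<open>Otherwise F would be a multiple of X^d on Y = 0 and vanish there at (0, 0, 1) to
    order d, more than D2 does. In \<open>?H\<close> and \<open>?L\<close> the line Y = 0 is moved
    to X = 0.\<close>
  have P3: "coeff3 F d 0 0 = 0"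
  proof (rule ccontr)
    assume c: "coeff3 F d 0 0 \<noteq> 0"
    let ?H = "subst3 varY varX varZ F"
    let ?L = "subst3 varX varZ varY ?H"
    have H: "D2_comp d ?H" by (rule D2_comp_subst(1)[OF F(1)])
    have L: "D2_comp d ?L" by (rule D2_comp_subst(2)[OF H])
    have hH: "homogeneous3 d ?H" "homogeneous3 d ?L" using H L by (auto simp: D2_comp_def)
    have "aff ?H dvd aff D2" "aff ?L dvd aff D2"
      using H L dvd_image[OF rhom_aff] by (auto simp: D2_comp_def)
    have "coeff (aff ?H) 0 \<noteq> 0" using c by (simp add: coeff_aff_homogeneous[OF hH(1)] coeff3_swaps)
    then have k0: "poly (aff ?H) 0 \<noteq> 0" by (simp add: poly_0_coeff_0)
    \<comment> \<open>A root a would lie in F_q, and invariance under the shift by a would make the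
      value at 0 vanish too.\<close>
    have "poly (aff ?H) a \<noteq> 0" for a
    proof
      assume a: "poly (aff ?H) a = 0"
      then have "poly (aff D2) a = 0" using \<open>aff ?H dvd aff D2\<close> by (auto elim!: dvdE)
      then have aq: "a \<in> Fq" by (rule aff_D2_props(3))
      have "subst3 varY varX varZ (subst3 varX varY (varZ + const3 a * varX) F) = ?H"
        using zx aq by (simp add: inv_zx_def)
      then have "subst3 varX varY (varZ + const3 a * varY) ?H = ?H" by (simp add: s)
      moreover have "aff (subst3 varX varY (varZ + const3 a * varY) G) = pcompose (aff G) (indet + [:a:])" for G
        by (simp add: aff_subst3 pcompose_aff)
      ultimately have "aff ?H = pcompose (aff ?H) (indet + [:a:])" by metis
      moreover have "poly (pcompose g (indet + [:a:])) 0 = poly g a" for g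
        by (simp add: poly_pcompose indet_def)
      ultimately have "poly (aff ?H) 0 = poly (aff ?H) a" by metis
      then show False using k0 a by simp
    qed
    then have "degree (aff ?H) = 0" using alg_closed[of "aff ?H"] by (metis less_one not_le)
    then have z: "coeff3 F i 0 j = 0" if "j > 0" for i j
    proof (cases "i + j = d")
      case True
      then have "coeff (aff ?H) j = coeff3 F i 0 j"
        by (auto simp: coeff_aff_homogeneous[OF hH(1)] coeff3_swaps)
      then show ?thesis using \<open>degree (aff ?H) = 0\<close> that by (metis coeff_eq_0)
    next
      case False
      then show ?thesis using d unfolding homogeneous3_def by (metis add_0_right)
    qed
    have "coeff (aff ?L) k = 0" if "k < d" for k
      using that z by (simp add: coeff_aff_homogeneous[OF hH(2)] coeff3_swap_YZ coeff3_swaps)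
    then have "monom 1 d dvd aff ?L" by (simp add: monom_1_dvd_iff')
    then have "monom 1 d dvd aff D2" using \<open>aff ?L dvd aff D2\<close> by (rule dvd_trans)
    then have "d \<le> q * (q - 1)" using aff_D2_props(1,4) by (simp add: monom_1_dvd_iff)
    then show False using \<open>q * (q - 1) < d\<close> by simp
  qed
  have xz: "inv_xz F"
    unfolding inv_xz_def
  proof
    fix a assume a: "a \<in> Fq"
    have "inv_zx (subst3 varZ varY varX F)"
      using D2_comp_centre(1)[OF D2_comp_subst(3)[OF F(1)]] P3 by (simp add: coeff3_swaps)
    then have "subst3 varX varY (varZ + const3 a * varX) (subst3 varZ varY varX F) = subst3 varZ varY varX F"
      using a by (simp add: inv_zx_def)
    from arg_cong[OF this, of "subst3 varZ varY varX"]
    show "subst3 (varX + const3 a * varZ) varY varZ F = F" by (simp add: s)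
  qed
  obtain v w where vw: "v \<le> w" "w \<ge> 1" "d = q * (q - 1) * (v + q * w)" "ord0 (aff F) = q * (q - 1) * v"
    using invariant_degree[OF d \<open>d > 0\<close> f zx zy yz xz] by blast
  \<comment> \<open>The vertex (0, 1, 0) on F excludes v = 0, and v, w >= 1 already give the full
    degree of D2.\<close>
  have "v \<ge> 1" using o0 vw(4) by (cases v) auto
  then have "1 + q \<le> v + q * w" using vw(2) by (intro add_mono) auto
  then have "q ^ 3 - q \<le> d" unfolding homogeneous_degree_D2(2) vw(3) by (intro mult_le_mono) auto
  obtain d' e' where de: "homogeneous3 d' F" "homogeneous3 e' G" "d' + e' = q ^ 3 - q"
    using homogeneous3_factor[of _ F G] homogeneous3_D(2) aff_D2_props(2) G by metis
  have nz: "F \<noteq> 0" "G \<noteq> 0" using aff_D2_props(2) G by auto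
  have "d' = d" by (rule homogeneous3_unique[OF de(1) d nz(1)])
  then have "e' = 0" using de(3) \<open>q ^ 3 - q \<le> d\<close> by simp
  then have "G dvd 1" using homogeneous3_nonunit[OF de(2) nz(2)] by simp
  then show ?thesis using irr unfolding G by (simp add: irreducible_mult_unit_right)
qed

end

subsection \<open>Uniqueness and the main theorem\<close>

lemma extract_varX:
  fixes D :: "'k::field poly3"
  assumes "homogeneous3 d D" "D \<noteq> 0"
  shows "\<exists>e R. D = varX ^ e * R \<and> homogeneous3 (d - e) R \<and> aff R \<noteq> 0 \<and> e \<le> d"
  using assms
proof (induct d arbitrary: D rule: less_induct)
  case (less d)
  show ?case
  proof (cases "aff D = 0")
    case False
    then show ?thesis using less(2) by (intro exI[of _ 0] exI[of _ D]) simp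
  next
    case True
    then obtain G where G: "D = varX * G" using varX_dvd_iff[OF less(2)] by blast
    have nz: "varX \<noteq> (0 :: 'k poly3)" "G \<noteq> 0" using less(3) G by auto
    obtain d' e where de: "homogeneous3 d' (varX :: 'k poly3)" "homogeneous3 e G" "d' + e = d"
      using homogeneous3_factor[of d varX G] less(2,3) G by metis
    have "d' = 1" by (rule homogeneous3_unique[OF de(1) homogeneous3_var(1) nz(1)])
    then have "e < d" using de(3) by simp
    from less(1)[OF this de(2) nz(2)] obtain i R where
      R: "G = varX ^ i * R" "homogeneous3 (e - i) R" "aff R \<noteq> 0" "i \<le> e" by blast
    show ?thesis
      using R G de(3) \<open>d' = 1\<close> by (intro exI[of _ "Suc i"] exI[of _ R]) (auto simp: mult.assoc)
  qed
qed

context closed_field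
begin

lemma SL3_subst:
  assumes F: "a \<in> Fq" "b \<in> Fq" "c \<in> Fq" "d \<in> Fq" "e \<in> Fq" "f \<in> Fq" "g \<in> Fq" "h \<in> Fq" "k \<in> Fq"
    and det: "a * (e * k - f * h) - b * (d * k - f * g) + c * (d * h - e * g) = 1"
  shows "\<exists>A\<in>SL3 q. \<forall>F. transform3 A F = subst3 (lin a b c) (lin d e f) (lin g h k) F"
proof -
  define A :: "'k ^3^3" where "A = vector [vector [a, b, c], vector [d, e, f], vector [g, h, k]]"
  have A: "A \<in> SL3 q"
    using F det by (simp add: SL3_def A_def forall_3 vector_3 Fq_def Determinants.det_3 algebra_simps)
  have "transform3 A F = subst3 (lin a b c) (lin d e f) (lin g h k) F" for F
    by (simp add: transform3_def eval3_eq_ev linrow_def lin_def A_def vector_3)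
  with A show ?thesis by blast
qed

lemma elementary_lin:
  "varZ + const3 a * varX = lin a 0 1" "varZ + const3 a * varY = lin 0 a 1"
  "varY + const3 a * varZ = lin 0 1 a" "varX + const3 a * varZ = lin 1 0 a"
  by (simp_all add: lin_def const3_simps add.commute)

text \<open>For shifts of Z the multiplier is trivial by \<open>shift_semi_invariant\<close>. The
  families yz and xz are reduced to this case by renaming the variables of F so that the shifted one
  becomes Z.\<close>

lemma SL3_semi_invariant:
  assumes F0: "F \<noteq> 0" and F: "\<forall>A\<in>SL3 q. \<exists>c. c \<noteq> 0 \<and> transform3 A F = const3 c * F"
  shows "inv_zx F" "inv_zy F" "inv_yz F" "inv_xz F"
proof -
  note s = ev_subst3 rhom_const3 rhomD[OF rhom_subst3] ev_id
  have semi: "\<exists>s. subst3 (lin a b c) (lin d e f) (lin g h k) F = const3 s * F"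
    if "a \<in> Fq" "b \<in> Fq" "c \<in> Fq" "d \<in> Fq" "e \<in> Fq" "f \<in> Fq" "g \<in> Fq" "h \<in> Fq" "k \<in> Fq"
      "a * (e * k - f * h) - b * (d * k - f * g) + c * (d * h - e * g) = 1" for a b c d e f g h k
    using SL3_subst[OF that] F by metis
  have shift: "\<exists>c. subst3 varX varY (varZ + const3 a * varX) F = const3 c * F"
    "\<exists>c. subst3 varX varY (varZ + const3 a * varY) F = const3 c * F"
    "\<exists>c. subst3 varX (varY + const3 a * varZ) varZ F = const3 c * F"
    "\<exists>c. subst3 (varX + const3 a * varZ) varY varZ F = const3 c * F" if a: "a \<in> Fq" for a
    unfolding elementary_lin unfolding lin_var by (rule semi; use a in simp)+
  show "inv_zx F"
    unfolding inv_zx_def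
  proof
    fix a assume "a \<in> Fq"
    then show "subst3 varX varY (varZ + const3 a * varX) F = F"
      using shift(1)[of a] shift_semi_invariant[OF F0] unfolding const3_var_pCons by blast
  qed
  show "inv_zy F"
    unfolding inv_zy_def
  proof
    fix a assume "a \<in> Fq"
    then show "subst3 varX varY (varZ + const3 a * varY) F = F"
      using shift(2)[of a] shift_semi_invariant[OF F0] unfolding const3_var_pCons by blast
  qed
  show "inv_yz F"
    unfolding inv_yz_def
  proof
    fix a assume "a \<in> Fq"
    then obtain c where c: "subst3 varX (varY + const3 a * varZ) varZ F = const3 c * F" using shift(3) by blast
    let ?G = "subst3 varX varZ varY F"
    have "subst3 varX varZ varY ?G = F" by (simp add: s)
    then have G0: "?G \<noteq> 0" using F0 rhomD(1)[OF rhom_subst3] by metis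
    have "subst3 varX varY (varZ + const3 a * varY) ?G = const3 c * ?G"
      using arg_cong[OF c, of "subst3 varX varZ varY"] by (simp add: s)
    then have "subst3 varX varY (varZ + const3 a * varY) ?G = ?G"
      unfolding const3_var_pCons by (rule shift_semi_invariant[OF G0])
    from arg_cong[OF this, of "subst3 varX varZ varY"]
    show "subst3 varX (varY + const3 a * varZ) varZ F = F" by (simp add: s)
  qed
  show "inv_xz F"
    unfolding inv_xz_def
  proof
    fix a assume "a \<in> Fq"
    then obtain c where c: "subst3 (varX + const3 a * varZ) varY varZ F = const3 c * F" using shift(4) by blast
    let ?G = "subst3 varZ varY varX F"
    have "subst3 varZ varY varX ?G = F" by (simp add: s)
    then have G0: "?G \<noteq> 0" using F0 rhomD(1)[OF rhom_subst3] by metis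
    have "subst3 varX varY (varZ + const3 a * varX) ?G = const3 c * ?G"
      using arg_cong[OF c, of "subst3 varZ varY varX"] by (simp add: s)
    then have "subst3 varX varY (varZ + const3 a * varX) ?G = ?G"
      unfolding const3_var_pCons by (rule shift_semi_invariant[OF G0])
    from arg_cong[OF this, of "subst3 varZ varY varX"]
    show "subst3 (varX + const3 a * varZ) varY varZ F = F" by (simp add: s)
  qed
qed

lemma inv_D1: "inv_zx D1" "inv_zy D1" "inv_yz D1" "inv_xz D1"
  unfolding inv_zx_def inv_zy_def inv_yz_def inv_xz_def elementary_lin unfolding lin_var
  by (intro ballI D_subst; simp)+

lemma inv_diff:
  assumes "inv_zx F" "inv_zy F" "inv_yz F" "inv_xz F"
  shows "inv_zx (F - const3 c * D1)" "inv_zy (F - const3 c * D1)"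
    "inv_yz (F - const3 c * D1)" "inv_xz (F - const3 c * D1)"
  using assms inv_D1 unfolding inv_zx_def inv_zy_def inv_yz_def inv_xz_def
  by (simp_all add: rhomD[OF rhom_subst3] rhom_const3)

lemma degree_D1: "q ^ 3 - q ^ 2 = q * (q - 1) * q"
  by (simp add: power2_eq_square power3_eq_cube algebra_simps)

text \<open>Let D = X^e R with e maximal. By symmetry Z^e divides R, and by translation invariance so does
  (Z^q - X^(q-1) Z)^e. Thus T^(qe) divides R(0, 1, T), and then R has too large a degree.\<close>
lemma invariant_not_dvd_varX:
  assumes h: "homogeneous3 (q ^ 3 - q ^ 2) D" and D0: "D \<noteq> 0"
    and inv: "inv_zx D" "inv_zy D" "inv_yz D" "inv_xz D"
  shows "aff D \<noteq> 0"
proof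
  assume a0: "aff D = 0"
  let ?d = "q ^ 3 - q ^ 2"
  obtain e R where R: "D = varX ^ e * R" "homogeneous3 (?d - e) R" "aff R \<noteq> 0" "e \<le> ?d"
    using extract_varX[OF h D0] by blast
  have "e \<ge> 1" using a0 R(1,3) by (cases e) auto
  have X0: "varX \<noteq> (0 :: 'k poly3)" by (simp add: varX_def)
  \<comment> \<open>The families zx, zy and yz fix X, so their invariance passes to R. The family xz
    moves X, which is why \<open>shape\<close> is applied to R and not
    \<open>invariant_degree\<close>.\<close>
  have fixX: "subst3 varX A B R = R" if "subst3 varX A B D = D" for A B
  proof -
    have "varX ^ e * subst3 varX A B R = varX ^ e * R"
      using that unfolding R(1) by (simp add: rhomD[OF rhom_subst3] rhom_const3)
    then show ?thesis using X0 by simp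
  qed
  have invR: "inv_zx R" "inv_zy R" "inv_yz R"
    using inv(1-3) fixX unfolding inv_zx_def inv_zy_def inv_yz_def by blast+
  obtain e' u where eu: "e' \<le> u" "?d - e = q * (e' + q * u)" "ord0 (aff R) = q * e'"
    using shape[OF R(2,3) invR] by blast
  have R0: "R \<noteq> 0" using R(3) by auto
  \<comment> \<open>The Weyl element exchanging X and Z turns the factor X^e of D into Z^e up to
    sign, and this is prime to X^e.\<close>
  have "monom 1 e dvd R"
  proof -
    have "D = subst3 (- varZ) varY varX D"
      using weyl_xz[OF inv(1,4), of 1] by (simp add: const3_simps)
    also have "\<dots> = (- varZ) ^ e * subst3 (- varZ) varY varX R"
      unfolding R(1) by (simp add: rhomD[OF rhom_subst3] rhom_const3)
    finally have "(- varZ) ^ e dvd varX ^ e * R" unfolding R(1) by (rule dvdI)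
    then have "varZ ^ e dvd varX ^ e * R" by (simp add: power_minus[of "varZ :: 'k poly3" e] minus_one_power_iff split: if_splits)
    then have d: "monom 1 e dvd [:[:[:0, 1:] ^ e:]:] * R"
      by (simp add: varZ_def monom_altdef varX_def poly_const_pow)
    show ?thesis unfolding monom_1_dvd_iff'
    proof (intro allI impI)
      fix k assume "k < e"
      then have "coeff ([:[:[:0, 1:] ^ e:]:] * R) k = 0" using d unfolding monom_1_dvd_iff' by blast
      then show "coeff R k = 0" by simp
    qed
  qed
  then have oR: "e \<le> ord0 R" using R0 by (simp add: monom_1_dvd_iff)
  \<comment> \<open>\<open>NZ\<close> is divisible by Z only once, so Z^e divides P and
    \<open>NZ ^ e\<close> divides R.\<close>
  obtain P where P: "R = pcompose P NZ" using inv_zx_structure[OF invR(1)] by blast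
  have P0: "P \<noteq> 0" using R0 P by auto
  have N: "coeff NZ 0 = 0" "coeff NZ 1 \<noteq> 0" unfolding NZ_eq using q2 by auto
  then have N0: "NZ \<noteq> 0" by auto
  have "ord0 NZ \<le> 1" using ord0_props(2)[OF N0, of 1] N(2) by (meson not_le)
  moreover have "ord0 R = ord0 P * ord0 NZ"
    unfolding P using N(1) by (intro ord0_pcompose[OF P0 _ N0]) (simp add: poly_0_coeff_0)
  ultimately have "ord0 R \<le> ord0 P" by (metis mult.right_neutral mult_le_mono2)
  then have "monom 1 e dvd P" using oR P0 by (simp add: monom_1_dvd_iff)
  then obtain P' where P': "P = varZ ^ e * P'" by (auto simp: varZ_def monom_altdef elim: dvdE)
  have "aff R = monom 1 (q * e) * pcompose (aff P') (monom 1 q)"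
    unfolding P aff_pcompose_NZ P'
    by (simp add: indet_power pcompose_mult pcompose_monom monom_power)
  then have "monom 1 (q * e) dvd aff R" by simp
  then have "q * e \<le> q * e'" using R(3) eu(3) by (simp add: monom_1_dvd_iff)
  then have "e \<le> e'" using q2 by simp
  have de: "?d = e + q * (e' + q * u)" using eu(2) R(4) by simp
  \<comment> \<open>As q divides the degrees of D and R, it divides e. Then q <= e <= e' <= u, and R
    would have degree at least q^3.\<close>
  have "q dvd e + q * (e' + q * u)" unfolding de[symmetric] degree_D1 by simp
  then have "q dvd e" by (simp add: dvd_add_left_iff)
  then have "q \<le> e" using \<open>e \<ge> 1\<close> by (intro dvd_imp_le) auto
  then have "q \<le> u" using \<open>e \<le> e'\<close> eu(1) by simp
  then have "q * (q * q) \<le> q * (q * u)" by simp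
  moreover have "q * (q - 1) * q < q * (q * q)" using q2 by simp
  moreover have "q * (q * u) \<le> ?d" unfolding de by (simp add: distrib_left)
  ultimately show False unfolding degree_D1 by linarith
qed

lemma unique_invariant:
  assumes h: "homogeneous3 (q ^ 3 - q ^ 2) F" and inv: "inv_zx F" "inv_zy F" "inv_yz F" "inv_xz F"
  shows "\<exists>c. F = const3 c * D1"
proof -
  let ?d = "q ^ 3 - q ^ 2"
  \<comment> \<open>This multiple of D1 cancels the coefficient of T^d in
    \<open>aff F\<close>.\<close>
  define c where "c = coeff (aff F) ?d / coeff (aff D1) ?d"
  define D where "D = F - const3 c * D1"
  have "coeff (aff D1) ?d \<noteq> 0" using D1_nonzero(2,3) by (metis leading_coeff_0_iff)
  then have lc: "coeff (aff D) ?d = 0" by (simp add: D_def c_def)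
  have hD: "homogeneous3 ?d D"
    unfolding D_def using homogeneous3_mult[OF homogeneous3_const homogeneous3_D(1), of c]
    by (intro homogeneous3_diff h) simp
  have iD: "inv_zx D" "inv_zy D" "inv_yz D" "inv_xz D" unfolding D_def by (rule inv_diff[OF inv])+
  have "D = 0"
  proof (rule ccontr)
    assume "D \<noteq> 0"
    from invariant_not_dvd_varX[OF hD this iD] have a: "aff D \<noteq> 0" .
    have "?d > 0" unfolding degree_D1 using q2 by simp
    then obtain v w where vw: "w \<ge> 1" "?d = q * (q - 1) * (v + q * w)" "ord0 (aff D) = q * (q - 1) * v"
      using invariant_degree[OF hD _ a iD] by blast
    \<comment> \<open>Only v = 0, w = 1 is left. The order is then 0, so \<open>aff D\<close> has
      degree d, although its coefficient at T^d was cancelled.\<close>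
    have "v + q * w = q" using vw(2) q2 unfolding degree_D1 by simp
    then have "v = 0" using vw(1) by (cases w) auto
    then have "degree (aff D) = ?d"
      using ord0_plus_degree_aff[OF hD weyl_yz[OF iD(2,3)] a] vw(3) by simp
    then show False using lc a by (metis leading_coeff_0_iff)
  qed
  then show ?thesis unfolding D_def by auto
qed

text \<open>For w >= 1 the smallest value of v + q*w is q, and the next integer q + 1 corresponds to
  the degree of D2.\<close>

lemma invariant_curve_degree:
  fixes F :: "'k poly3"
  assumes F: "inv_irr_curve (SL3 q) d F" and d: "d \<ge> 2"
  shows "q ^ 3 - q ^ 2 \<le> d" "d > q ^ 3 - q ^ 2 \<Longrightarrow> q ^ 3 - q \<le> d"
proof -
  have h: "homogeneous3 d F" and i: "irreducible F" using F by (auto simp: inv_irr_curve_def)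
  have F0: "F \<noteq> 0" using i by auto
  have inv: "inv_zx F" "inv_zy F" "inv_yz F" "inv_xz F"
    using SL3_semi_invariant[OF F0] F by (auto simp: inv_irr_curve_def)
  \<comment> \<open>An irreducible form divisible by X is a scalar multiple of X, hence a
    line.\<close>
  have "aff F \<noteq> 0"
  proof
    assume "aff F = 0"
    then obtain G where G: "F = varX * G" using varX_dvd_iff[OF h] by blast
    have nz: "varX \<noteq> (0 :: 'k poly3)" "G \<noteq> 0" using F0 G by auto
    have "\<not> varX dvd (1 :: 'k poly3)" using homogeneous3_nonunit[OF homogeneous3_var(1) nz(1)] by simp
    then have "G dvd 1" using i G irreducibleD by blast
    obtain d' e where de: "homogeneous3 d' (varX :: 'k poly3)" "homogeneous3 e G" "d' + e = d"
      using homogeneous3_factor[of d varX G] h F0 G by metis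
    have "d' = 1" by (rule homogeneous3_unique[OF de(1) homogeneous3_var(1) nz(1)])
    moreover have "e = 0" using homogeneous3_nonunit[OF de(2) nz(2)] \<open>G dvd 1\<close> by simp
    ultimately show False using de(3) d by simp
  qed
  then obtain v w where vw: "v \<le> w" "w \<ge> 1" "d = q * (q - 1) * (v + q * w)"
    using invariant_degree[OF h _ _ inv] d by auto
  have "q \<le> v + q * w" using vw(2) by (cases w) auto
  then show "q ^ 3 - q ^ 2 \<le> d" unfolding degree_D1 vw(3) by simp
  assume "d > q ^ 3 - q ^ 2"
  then have lt: "q < v + q * w" unfolding degree_D1 vw(3) by simp
  have "1 + q \<le> v + q * w" using lt by simp
  then show "q ^ 3 - q \<le> d" unfolding homogeneous_degree_D2(2) vw(3) by (rule mult_le_mono2)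
qed

lemma D1_curve: "inv_irr_curve (SL3 q) (q ^ 3 - q ^ 2) D1"
  using homogeneous3_D(1) irreducible_D1 transform3_D(1)
  by (auto simp: inv_irr_curve_def const3_simps intro!: exI[of _ 1])

lemma D2_curve: "inv_irr_curve (SL3 q) (q ^ 3 - q) D2"
  using homogeneous3_D(2) irreducible_D2 transform3_D(2)
  by (auto simp: inv_irr_curve_def const3_simps intro!: exI[of _ 1])

lemma degrees:
  "dG (SL3 q :: ('k ^3^3) set) = q ^ 3 - q ^ 2"
  "d'G (SL3 q :: ('k ^3^3) set) = q ^ 3 - q"
proof -
  have "q * (q - 1) \<ge> 2 * 1" using q2 by (intro mult_le_mono) auto
  then have "q * (q - 1) * q \<ge> 2 * 1 * 2" using q2 by (intro mult_le_mono) auto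
  then have d2: "q ^ 3 - q ^ 2 \<ge> 2" unfolding degree_D1 by simp
  show dG: "dG (SL3 q :: ('k ^3^3) set) = q ^ 3 - q ^ 2"
    unfolding dG_def using D1_curve d2 invariant_curve_degree(1) by (intro Least_equality) blast+
  have lt: "q ^ 3 - q ^ 2 < q ^ 3 - q"
    unfolding degree_D1 homogeneous_degree_D2(2) using q2 by simp
  show "d'G (SL3 q :: ('k ^3^3) set) = q ^ 3 - q"
    unfolding d'G_def dG
  proof (rule Least_equality)
    show "q ^ 3 - q ^ 2 < q ^ 3 - q \<and> (\<exists>F :: 'k poly3. inv_irr_curve (SL3 q) (q ^ 3 - q) F)"
      using lt D2_curve by blast
    fix d assume "q ^ 3 - q ^ 2 < d \<and> (\<exists>F :: 'k poly3. inv_irr_curve (SL3 q) d F)"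
    then show "q ^ 3 - q \<le> d" using invariant_curve_degree(2) d2 by (meson less_imp_le order_trans)
  qed
qed

end

theorem mainTheorem9:
  fixes p q n :: nat
  assumes "prime p" and "n \<ge> 1" and "q = p ^ n"
    and "CHAR('k::field) = p"
    and "\<forall>P :: 'k poly. degree P \<ge> 1 \<longrightarrow> (\<exists>x. poly P x = 0)"
    and "\<forall>x :: 'k. \<exists>m \<ge> 1. x ^ (p ^ m) = x"
  shows "dG (SL3 q :: ('k ^3^3) set) = q^3 - q^2
     \<and> epsG (SL3 q :: ('k ^3^3) set) = q^2 - q
     \<and> inv_irr_curve (SL3 q) (q^3 - q^2) (DGZ q :: 'k poly3)
     \<and> (\<forall>F :: 'k poly3. inv_irr_curve (SL3 q) (q^3 - q^2) F \<longrightarrow>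
          (\<exists>c. c \<noteq> 0 \<and> F = const3 c * DGZ q))"
proof -
  interpret closed_field p q n "TYPE('k)"
    by standard (use assms in auto)
  have "q ^ 1 \<le> q ^ 2" "q ^ 2 \<le> q ^ 3" using q2 by (intro power_increasing; simp)+
  then have "epsG (SL3 q :: ('k ^3^3) set) = q ^ 2 - q"
    unfolding epsG_def degrees by simp
  moreover have "\<exists>c. c \<noteq> 0 \<and> F = const3 c * D1"
    if F: "inv_irr_curve (SL3 q) (q ^ 3 - q ^ 2) F" for F :: "'k poly3"
  proof -
    have F0: "F \<noteq> 0" using F by (auto simp: inv_irr_curve_def)
    have h: "homogeneous3 (q ^ 3 - q ^ 2) F"
      and s: "\<forall>A\<in>SL3 q. \<exists>c. c \<noteq> 0 \<and> transform3 A F = const3 c * F"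
      using F by (auto simp: inv_irr_curve_def)
    obtain c where "F = const3 c * D1"
      using unique_invariant[OF h SL3_semi_invariant[OF F0 s]] by blast
    with F0 show ?thesis by (intro exI[of _ c]) (auto simp: const3_simps)
  qed
  ultimately show ?thesis
    unfolding DGZ_eq using degrees(1) D1_curve by blast
qed

end
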